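(* For $|z|=1$ the following asymptotic formulas hold (as $n\to\infty$): (1) $$\prod_{j=2}^4(t_1t_j;q)_\infty\,R_n(z;\mathbf t\,|\,q)=\Big(\frac{t_1}{z}\Big)^n\frac{\prod_{j=1}^4(t_jz;q)_\infty}{(z^2;q)_\infty}\big[1+\mathcal O(q^{n/2})\big]+(t_1z)^n\frac{\prod_{j=1}^4(t_j/z;q)_\infty}{(1/z^2;q)_\infty}\big[1+\mathcal O(q^{n/2})\big].$$ (2) $$\frac{(qz^{-2};q)_\infty\prod_{j=2}^4(qt_1t_j;q)_\infty}{(qt_1/z,qt_2/z,t_3/z,t_4/z;q)_\infty}\,S_n(z;\mathbf t\,|\,q)=t_1^{n-1}z^n\big[1+\mathcal O(q^{n/2})\big].$$ (3) $$\frac{(qz^{-2};q)_\infty(qt_1t_2;q)_\infty\prod_{j=3}^4(t_1t_j;q)_\infty}{\prod_{j=1}^2(qt_j/z,t_{j+2}/z;q)_\infty}\,T_n(z;\mathbf t\,|\,q)=(t_1z)^n\big[1+\mathcal O(q^{n/2})\big].$$ (4) $$\frac{\prod_{j=2}^4(qt_1t_j;q)_\infty}{1-qt_1t_2}\,U_n(z;\mathbf t\,|\,q)=\frac{(qt_1)^{n-1}}{z^n}\frac{\prod_{j=1}^4(t_jz;q)_\infty}{(z^2;q)_\infty}\big[1+\mathcal O(q^{n/2})\big]+(qt_1)^{n-1}z^{n-2}\frac{(1-t_1z)(1-t_2z)\prod_{j=1}^4(t_j/z;q)_\infty}{(1/z^2;q)_\infty(1-t_1/z)(1-t_2/z)}\big[1+\mathcal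 O(q^{n/2})\big].$$
   Context: Standing assumptions: $0<q<1$; $\mathbf t=(t_1,t_2,t_3,t_4)$ with each $t_i$ real and $|t_i|<1$. Notation: $(a;q)_k=\prod_{i=0}^{k-1}(1-aq^i)$, $(a;q)_\infty=\prod_{i\ge0}(1-aq^i)$, $(a_1,\dots,a_r;q)_k=\prod_j(a_j;q)_k$, and ${}_4\phi_3(a_1,a_2,a_3,a_4;b_1,b_2,b_3;q,q)=\sum_{k\ge 0}\frac{(a_1,a_2,a_3,a_4;q)_k}{(q,b_1,b_2,b_3;q)_k}q^k$. $R_n(z;\mathbf t\,|\,q)={}_4\phi_3(q^{-n},t_1t_2t_3t_4q^{n-1},t_1z,t_1/z;\;t_1t_2,t_1t_3,t_1t_4;q,q)$. For $n\ge1$, $S_n(z;\mathbf t\,|\,q)=z(1-t_3/z)(1-t_4/z)\;{}_4\phi_3(q^{1-n},t_1t_2t_3t_4q^{n},t_1z,qt_1/z;\;qt_1t_2,qt_1t_3,qt_1t_4;q,q)$. $T_n(z;\mathbf t\,|\,q)={}_4\phi_3(q^{-n},t_1t_2t_3t_4q^{n-1},t_1z,qt_1/z;\;qt_1t_2,t_1t_3,t_1t_4;q,q)$. For $n\ge1$, $U_n(z;\mathbf t\,|\,q)=\frac1z(1-t_1z)(1-t_2z)\,R_{n-1}(z;qt_1,qt_2,t_3,t_4\,|\,q)$. *)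

theory Defs
  imports "HOL-Analysis.Analysis" "HOL-Library.Landau_Symbols"
begin

text \<open>
  The multi-parameter \<open>q\<close>-shifted factorials
  $(a_1,\dots,a_r;q)_k$ and $(a_1,\dots,a_r;q)_\infty$; the parameters are given as a list.
\<close>

definition qpoch :: "complex list \<Rightarrow> complex \<Rightarrow> nat \<Rightarrow> complex" where
  "qpoch as q k = (\<Prod>a\<leftarrow>as. \<Prod>i<k. 1 - a * q ^ i)"

definition qpoch_inf :: "complex list \<Rightarrow> complex \<Rightarrow> complex" where
  "qpoch_inf as q = (\<Prod>a\<leftarrow>as. prodinf (\<lambda>i. 1 - a * q ^ i))"

definition phi43 ::
  "complex \<Rightarrow> complex \<Rightarrow> complex \<Rightarrow> complex \<Rightarrow> complex \<Rightarrow> complex \<Rightarrow> complex \<Rightarrow> complex \<Rightarrow> complex \<Rightarrow> complex"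
where
  "phi43 a1 a2 a3 a4 b1 b2 b3 q x =
     (\<Sum>k. qpoch [a1, a2, a3, a4] q k / qpoch [q, b1, b2, b3] q k * x ^ k)"

text \<open>
  In the four families below the exponents of \<open>q\<close> may be negative, so integer powers are used.
\<close>

definition AW_R ::
  "nat \<Rightarrow> complex \<Rightarrow> complex \<Rightarrow> complex \<Rightarrow> complex \<Rightarrow> complex \<Rightarrow> complex \<Rightarrow> complex"
where
  "AW_R n z t1 t2 t3 t4 q =
     phi43 (q powi (- int n)) (t1 * t2 * t3 * t4 * q powi (int n - 1)) (t1 * z) (t1 / z)
           (t1 * t2) (t1 * t3) (t1 * t4) q q"

text \<open>\<open>AW_S\<close> and \<open>AW_U\<close> are only meaningful for \<open>n \<ge> 1\<close>.\<close>

definition AW_S ::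
  "nat \<Rightarrow> complex \<Rightarrow> complex \<Rightarrow> complex \<Rightarrow> complex \<Rightarrow> complex \<Rightarrow> complex \<Rightarrow> complex"
where
  "AW_S n z t1 t2 t3 t4 q =
     z * (1 - t3 / z) * (1 - t4 / z) *
     phi43 (q powi (1 - int n)) (t1 * t2 * t3 * t4 * q ^ n) (t1 * z) (q * t1 / z)
           (q * t1 * t2) (q * t1 * t3) (q * t1 * t4) q q"

definition AW_T ::
  "nat \<Rightarrow> complex \<Rightarrow> complex \<Rightarrow> complex \<Rightarrow> complex \<Rightarrow> complex \<Rightarrow> complex \<Rightarrow> complex"
where
  "AW_T n z t1 t2 t3 t4 q =
     phi43 (q powi (- int n)) (t1 * t2 * t3 * t4 * q powi (int n - 1)) (t1 * z) (q * t1 / z)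
           (q * t1 * t2) (t1 * t3) (t1 * t4) q q"

definition AW_U ::
  "nat \<Rightarrow> complex \<Rightarrow> complex \<Rightarrow> complex \<Rightarrow> complex \<Rightarrow> complex \<Rightarrow> complex \<Rightarrow> complex"
where
  "AW_U n z t1 t2 t3 t4 q =
     1 / z * (1 - t1 * z) * (1 - t2 * z) * AW_R (n - 1) z (q * t1) (q * t2) t3 t4 q"

text \<open>
  \<open>bigO_qhalf q\<close> is the class $\mathcal{O}(q^{n/2})$ (as $n \to \infty$) of complex sequences; the
  implied constant may depend on everything except \<open>n\<close>.
\<close>

definition bigO_qhalf :: "real \<Rightarrow> (nat \<Rightarrow> complex) set" where
  "bigO_qhalf q = O(\<lambda>n. of_real (q powr (real n / 2)))"

end

theory Submission
  imports Defs
begin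

text \<open>
  Everything reduces to \<open>AW_T\<close>: \<open>AW_S\<close> is \<open>AW_T\<close> with shifted parameters, \<open>AW_R\<close> is a combination of
  \<open>AW_T\<close> at \<open>z\<close> and at \<open>1 / z\<close>, and \<open>AW_U\<close> is a shifted \<open>AW_R\<close>. Sears' transformation turns
  \<open>AW_T\<close> into \<open>(t1 * z) ^ n\<close> times a convolution of two sequences: the terms of a \<open>2\<phi>1\<close> series with
  argument \<open>q / z\<^sup>2\<close>, which decay like \<open>q ^ n\<close>, and a ratio of \<open>q\<close>-shifted factorials, which
  converges at the rate \<open>q ^ n\<close>. Hence the convolution converges with error \<open>O(q powr (n / 2))\<close>, and its
  limit is evaluated by the \<open>q\<close>-Gauss sum. As \<open>z\<close> occurs with argument \<open>q / z\<^sup>2\<close> of modulus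
  \<open>q < 1\<close>, the case \<open>z\<^sup>2 = 1\<close> needs no separate treatment for \<open>AW_T\<close> and \<open>AW_S\<close>.
\<close>

section \<open>Finite q-shifted factorials, Gaussian binomials and sign factors\<close>

section \<open>Terminating \<open>q\<close>-series identities\<close>

text \<open>A single parameter over an arbitrary field: the terminating identities are pure algebra,
  and only the limit arguments specialise to the complex numbers.\<close>

definition qfac :: "'a::field \<Rightarrow> 'a \<Rightarrow> nat \<Rightarrow> 'a" where
  "qfac q a k = (\<Prod>i<k. 1 - a * q ^ i)"

text \<open>The Gaussian binomial coefficient. The value 0 for \<open>k > n\<close> lets sums be
  extended by one index in the induction for \<open>qsaalschuetz_poly\<close> and truncates the
  series in \<open>phi43_terminating\<close>.\<close>

definition qbin :: "'a::field \<Rightarrow> nat \<Rightarrow> nat \<Rightarrow> 'a" where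
  "qbin q n k = (if k \<le> n then qfac q q n / (qfac q q k * qfac q q (n - k)) else 0)"

text \<open>\<open>qsgn q k\<close> is $(-1)^k q^{k(k-1)/2}$; the product form avoids halving the exponent.\<close>

definition qsgn :: "'a::field \<Rightarrow> nat \<Rightarrow> 'a" where
  "qsgn q k = (\<Prod>i<k. - (q ^ i))"

lemma qfac_0 [simp]: "qfac q a 0 = 1"
  by (simp add: qfac_def)

lemma qfac_Suc: "qfac q a (Suc k) = qfac q a k * (1 - a * q ^ k)"
  by (simp add: qfac_def)

lemma qfac_add: "qfac q a (j + m) = qfac q a j * qfac q (a * q ^ j) m"
  by (induction m) (simp_all add: qfac_Suc power_add mult.assoc)

lemma qfac_Suc_left: "qfac q a (Suc k) = (1 - a) * qfac q (a * q) k"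
  using qfac_add[of q a 1 k] by (simp add: qfac_Suc)

lemma qfac_nonzeroI: "(\<And>i. a * q ^ i \<noteq> 1) \<Longrightarrow> qfac q a k \<noteq> 0"
  by (auto simp: qfac_def)

lemma qsgn_Suc: "qsgn q (Suc k) = - (q ^ k) * qsgn q k"
  by (simp add: qsgn_def)

lemma qsgn_0 [simp]: "qsgn q 0 = 1"
  by (simp add: qsgn_def)

lemma qsgn_add: "qsgn q (j + m) = qsgn q j * qsgn q m * q ^ (j * m)"
  by (induction m) (simp_all add: qsgn_Suc power_add algebra_simps)

text \<open>Squaring undoes the halving of the exponent. This is how the quadratic powers of
  \<open>q\<close> cancel in the two summation proofs.\<close>

lemma qsgn_square: "qsgn q m ^ 2 * q ^ m = q ^ (m * m)"
  by (induction m) (simp_all add: qsgn_Suc power_add algebra_simps power2_eq_square)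

lemma qsgn_nonzero: "q \<noteq> 0 \<Longrightarrow> qsgn q m \<noteq> 0"
  by (simp add: qsgn_def)

text \<open>Reverse the order of the factors and pull \<open>- (q ^ (m - Suc i))\<close> out of
  each. Dividing by \<open>q\<close> stands for the exponent \<open>m - 1\<close> without truncated
  subtraction.\<close>

lemma prod_qpower_reverse:
  assumes "q \<noteq> 0"
  shows "(\<Prod>i<m. y * q ^ m / q - q ^ i) = qsgn q m * qfac q y m"
proof -
  have "(\<Prod>i<m. y * q ^ m / q - q ^ i) = (\<Prod>i<m. y * q ^ m / q - q ^ (m - Suc i))"
    by (rule prod.nat_diff_reindex[symmetric])
  also have "\<dots> = (\<Prod>i<m. - (q ^ (m - Suc i)) * (1 - y * q ^ i))"
  proof (rule prod.cong)
    fix i assume "i \<in> {..<m}"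
    then obtain l where "m = Suc (i + l)"
      using less_natE by auto
    then show "y * q ^ m / q - q ^ (m - Suc i) = - (q ^ (m - Suc i)) * (1 - y * q ^ i)"
      using assms by (simp add: power_add algebra_simps)
  qed simp
  also have "\<dots> = (\<Prod>i<m. - (q ^ (m - Suc i))) * qfac q y m"
    unfolding qfac_def by (rule prod.distrib)
  also have "(\<Prod>i<m. - (q ^ (m - Suc i))) = qsgn q m"
    unfolding qsgn_def by (rule prod.nat_diff_reindex)
  finally show ?thesis .
qed

section \<open>The q-Pascal rules and the q-Pfaff-Saalschuetz sum\<close>

context
  fixes q :: "'a::field"
  assumes q0: "q \<noteq> 0" and q1: "\<And>i. q ^ Suc i \<noteq> 1"
begin

lemma qfac_q_nonzero: "qfac q q k \<noteq> 0"
  using q1 by (intro qfac_nonzeroI) simp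

lemma qbin_0: "qbin q n 0 = 1"
  using qfac_q_nonzero by (simp add: qbin_def)

lemma qbin_self: "qbin q n n = 1"
  using qfac_q_nonzero by (simp add: qbin_def)

text \<open>Both sides are linear in \<open>d\<close>. The constant terms give one q-Pascal rule and
  the coefficients of \<open>d\<close> give the other, up to a common power of
  \<open>q\<close>.\<close>

lemma qbin_pascal:
  "qbin q (Suc (Suc (j + m))) (Suc j) * (1 - d * q ^ Suc (j + m)) =
     qbin q (Suc (j + m)) j * (1 - d * q ^ j) * q ^ Suc m
     + qbin q (Suc (j + m)) (Suc j) * (1 - d * q ^ (Suc (j + m) + Suc j))"
proof -
  have nz: "1 - q * q ^ i \<noteq> 0" for i
    using q1[of i] by simp
  have e: "Suc (Suc (j + m)) - Suc j = Suc m" "Suc (j + m) - j = Suc m" by auto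
  show ?thesis
    using qfac_q_nonzero[of j] qfac_q_nonzero[of m] nz[of j] nz[of m]
    by (simp add: qbin_def e qfac_Suc) (simp add: divide_simps, simp add: power_add algebra_simps)
qed

lemma qbin_trinomial:
  "qbin q (j + (m + l)) (j + m) * qbin q (j + m) j = qbin q (j + (m + l)) j * qbin q (m + l) m"
proof -
  have e: "j + (m + l) - (j + m) = l" by auto
  show ?thesis
    using qfac_q_nonzero by (simp add: qbin_def e)
qed

text \<open>
  The \<open>q\<close>-Pfaff-Saalschuetz sum as a polynomial identity: it expresses one Askey-Wilson type
  basis in the variable \<open>l\<close> through another, and the induction only multiplies by one more factor.
  The extra homogeneity variable \<open>s\<close> avoids all divisions by parameters.
\<close>

lemma qsaalschuetz_poly:
  "(\<Prod>i<k. s + r * d * q ^ (2 * i) - q ^ i * l) =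
     (\<Sum>j\<le>k. qbin q k j * (\<Prod>i<k - j. s - r * q ^ i) * qfac q (d * q ^ j) (k - j)
        * (\<Prod>i<j. r + s * d * q ^ (2 * i) - q ^ i * l))"
proof (induction k)
  case 0
  then show ?case by (simp add: qbin_0)
next
  case (Suc k)
  define U where "U m = (\<Prod>i<m. s - r * q ^ i)" for m
  define P where "P j = (\<Prod>i<j. r + s * d * q ^ (2 * i) - q ^ i * l)" for j
  define D where "D j m = qfac q (d * q ^ j) m" for j m
  have U_Suc: "U (Suc m) = U m * (s - r * q ^ m)" for m
    by (simp add: U_def)
  have P_Suc: "P (Suc j) = P j * (r + s * d * q ^ (2 * j) - q ^ j * l)" for j
    by (simp add: P_def)
  have D_Suc: "D j (Suc m) = (1 - d * q ^ j) * D (Suc j) m" for j m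
    by (simp add: D_def qfac_Suc_left ac_simps)
  have D_Suc': "D j (Suc m) = D j m * (1 - d * q ^ (j + m))" for j m
    by (simp add: D_def qfac_Suc power_add mult.assoc)
  let ?c = "\<lambda>j. qbin q k j * U (k - j) * D j (k - j)"
  let ?l = "\<lambda>j. ?c j * q ^ (k - j) * P (Suc j)"
  let ?h = "\<lambda>j. qbin q k j * U (Suc k - j) * D j (k - j) * (1 - d * q ^ (k + j)) * P j"
  let ?g = "\<lambda>j. qbin q (Suc k) j * U (Suc k - j) * D j (Suc k - j) * P j"
  \<comment> \<open>The new factor equals \<open>q ^ (k - j)\<close> times the next factor of
    \<open>P j\<close>, plus a remainder free of \<open>l\<close>. The first part raises
    \<open>j\<close>; the second supplies the next factor of \<open>U\<close>.\<close>
  have step: "?c j * P j * (s + r * d * q ^ (2 * k) - q ^ k * l) = ?l j + ?h j" if "j \<le> k" for j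
  proof -
    obtain m where k: "k = j + m" using le_Suc_ex[OF \<open>j \<le> k\<close>] by blast
    have e: "k - j = m" "Suc k - j = Suc m" using k by auto
    have *: "s + r * d * q ^ (2 * k) - q ^ k * l =
        q ^ m * (r + s * d * q ^ (2 * j) - q ^ j * l) + (s - r * q ^ m) * (1 - d * q ^ (k + j))"
      unfolding k
      by (simp add: power_add power_mult power_mult_distrib power2_eq_square algebra_simps)
    show ?thesis
      unfolding e * U_Suc P_Suc distrib_left by (simp only: ac_simps)
  qed
  \<comment> \<open>The two contributions to index \<open>Suc j\<close> combine by
    \<open>qbin_pascal\<close>. For \<open>j = k\<close> only the first is present, since
    \<open>qbin q k (Suc k) = 0\<close>.\<close>
  have g: "?g (Suc j) = ?l j + ?h (Suc j)" if "j \<le> k" for j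
  proof (cases "j = k")
    case True
    then show ?thesis
      by (simp add: qbin_self) (simp add: qbin_def U_def D_def)
  next
    case False
    with that obtain m where k: "k = Suc (j + m)"
      by (metis less_iff_Suc_add le_neq_implies_less)
    have e: "k - j = Suc m" "Suc k - Suc j = Suc m" "k - Suc j = m"
      using k by auto
    have "D (Suc j) (Suc m) = D (Suc j) m * (1 - d * q ^ k)"
      unfolding k by (simp add: D_Suc')
    then have "?g (Suc j) = U (Suc m) * D (Suc j) m * P (Suc j) *
        (qbin q (Suc k) (Suc j) * (1 - d * q ^ k))"
      unfolding e by (simp only: ac_simps)
    also have "\<dots> = ?l j + ?h (Suc j)"
      unfolding e D_Suc[of j] qbin_pascal[of j m d, folded k] distrib_left by (simp only: ac_simps)
    finally show ?thesis .
  qed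
  have "(\<Prod>i<Suc k. s + r * d * q ^ (2 * i) - q ^ i * l) =
      (\<Sum>j\<le>k. ?c j * P j) * (s + r * d * q ^ (2 * k) - q ^ k * l)"
    using Suc by (simp add: U_def P_def D_def)
  also have "\<dots> = (\<Sum>j\<le>k. ?l j + ?h j)"
    unfolding sum_distrib_right by (rule sum.cong) (use step in auto)
  \<comment> \<open>The added term \<open>?h (Suc k)\<close> is zero because its binomial
    coefficient is.\<close>
  also have "\<dots> = (\<Sum>j\<le>k. ?l j) + (\<Sum>j\<le>Suc k. ?h j)"
    by (simp add: sum.distrib qbin_def)
  also have "\<dots> = ?h 0 + (\<Sum>j\<le>k. ?l j + ?h (Suc j))"
    by (simp only: sum.atMost_Suc_shift sum.distrib) (simp only: ac_simps)
  also have "\<dots> = ?g 0 + (\<Sum>j\<le>k. ?g (Suc j))"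
  proof -
    have "?h 0 = ?g 0"
      by (simp add: qbin_0 D_Suc')
    moreover have "(\<Sum>j\<le>k. ?l j + ?h (Suc j)) = (\<Sum>j\<le>k. ?g (Suc j))"
      by (rule sum.cong) (use g in auto)
    ultimately show ?thesis by simp
  qed
  also have "\<dots> = (\<Sum>j\<le>Suc k. ?g j)"
    by (rule sum.atMost_Suc_shift[symmetric])
  finally show ?case
    by (simp only: U_def P_def D_def)
qed

text \<open>The weight in front is (q^(-N);q)_m q^m / (q;q)_m written without negative powers, and
  \<open>u * q = x * p * r * q ^ N\<close> is the balancing condition of the 3phi2. With
  \<open>d = p * x\<close> and \<open>l = x + w * p\<close>, every trinomial factor in
  \<open>qsaalschuetz_poly\<close> splits into two linear ones.\<close>

lemma qsaalschuetz:
  assumes u: "u * q = x * p * r * q ^ N"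
    and nz: "qfac q (x * p) N \<noteq> 0" "qfac q (x * r) N \<noteq> 0"
  shows "(\<Sum>m\<le>N. qsgn q m * q ^ m / q ^ (N * m) * qbin q N m * (qfac q x m * qfac q u m)
            / (qfac q (x * p) m * qfac q (x * r) m)) =
         x ^ N * (qfac q p N * qfac q r N) / (qfac q (x * p) N * qfac q (x * r) N)"
proof -
  \<comment> \<open>This is the quotient of \<open>u\<close> by \<open>p\<close>, expressed through
    the balancing condition so that \<open>p\<close> may vanish.\<close>
  define w where "w = x * r * q ^ N / q"
  have wp: "w * p = u"
    using u q0 by (simp add: w_def field_simps)
  have "(\<Prod>i<N. w + 1 * (p * x) * q ^ (2 * i) - q ^ i * (x + w * p)) =
        (\<Prod>i<N. (w - x * q ^ i) * (1 - p * q ^ i))"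
    by (rule prod.cong) (auto simp: power_mult power2_eq_square algebra_simps power_mult_distrib)
  also have "\<dots> = (\<Prod>i<N. x * (r * q ^ N / q - q ^ i)) * qfac q p N"
  proof -
    have "w - x * q ^ i = x * (r * q ^ N / q - q ^ i)" for i
      by (simp add: w_def right_diff_distrib mult.assoc)
    then show ?thesis
      by (simp only: prod.distrib qfac_def)
  qed
  also have "\<dots> = x ^ N * (qsgn q N * qfac q r N) * qfac q p N"
    by (simp add: prod.distrib prod_qpower_reverse[OF q0])
  finally have lhs: "(\<Prod>i<N. w + 1 * (p * x) * q ^ (2 * i) - q ^ i * (x + w * p)) =
      x ^ N * (qsgn q N * qfac q r N) * qfac q p N" .
  have inner: "(\<Prod>i<m. 1 + w * (p * x) * q ^ (2 * i) - q ^ i * (x + w * p)) =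
      qfac q x m * qfac q u m" for m
    unfolding qfac_def prod.distrib[symmetric]
    by (rule prod.cong)
       (auto simp: power_mult power2_eq_square algebra_simps power_mult_distrib wp[symmetric])
  \<comment> \<open>Multiplying by the common denominator and \<open>qsgn q N\<close> turns the sum
    termwise into the right side of \<open>qsaalschuetz_poly\<close>.\<close>
  have "(\<Sum>m\<le>N. qsgn q m * q ^ m / q ^ (N * m) * qbin q N m * (qfac q x m * qfac q u m)
            / (qfac q (x * p) m * qfac q (x * r) m)) * (qsgn q N * qfac q (x * p) N * qfac q (x * r) N)
      = (\<Sum>m\<le>N. qbin q N m * (\<Prod>i<N - m. w - 1 * q ^ i) * qfac q (p * x * q ^ m) (N - m)
        * (\<Prod>i<m. 1 + w * (p * x) * q ^ (2 * i) - q ^ i * (x + w * p)))"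
    unfolding sum_distrib_right
  proof (rule sum.cong)
    fix m assume "m \<in> {..N}"
    then obtain l where N: "N = m + l"
      using le_Suc_ex by (metis atMost_iff)
    have e: "N - m = l" using N by simp
    have w: "w = (x * r * q ^ m) * q ^ l / q"
      by (simp add: w_def N power_add)
    have W: "(\<Prod>i<l. w - 1 * q ^ i) = qsgn q l * qfac q (x * r * q ^ m) l"
      unfolding mult_1 w by (rule prod_qpower_reverse[OF q0])
    have sgn: "qsgn q m * q ^ m / q ^ (N * m) * qsgn q N = qsgn q l"
    proof -
      have "qsgn q m * q ^ m * qsgn q N = (qsgn q m ^ 2 * q ^ m) * qsgn q l * q ^ (m * l)"
        by (simp add: N qsgn_add power2_eq_square)
      also have "\<dots> = qsgn q l * q ^ (N * m)"
        unfolding qsgn_square by (simp add: N power_add algebra_simps)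
      finally show ?thesis
        using q0 by (simp add: field_simps)
    qed
    have N_fac: "qfac q (x * p) N = qfac q (x * p) m * qfac q (p * x * q ^ m) l"
      "qfac q (x * r) N = qfac q (x * r) m * qfac q (x * r * q ^ m) l"
      by (simp_all add: N qfac_add mult.commute)
    have nzm: "qfac q (x * p) m \<noteq> 0" "qfac q (x * r) m \<noteq> 0"
      using nz N_fac by auto
    have rearrange: "A * B * (X * Y) / (C * D) * (S * (C * P) * (D * R)) = B * ((A * S) * R) * P * (X * Y)"
      if "C \<noteq> 0" "D \<noteq> 0" for A B C D X Y S P R :: 'a
      using that by (simp add: field_simps)
    show "qsgn q m * q ^ m / q ^ (N * m) * qbin q N m * (qfac q x m * qfac q u m)
            / (qfac q (x * p) m * qfac q (x * r) m) * (qsgn q N * qfac q (x * p) N * qfac q (x * r) N)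
      = qbin q N m * (\<Prod>i<N - m. w - 1 * q ^ i) * qfac q (p * x * q ^ m) (N - m)
        * (\<Prod>i<m. 1 + w * (p * x) * q ^ (2 * i) - q ^ i * (x + w * p))"
      unfolding e W inner N_fac rearrange[OF nzm] sgn ..
  qed simp
  also have "\<dots> = x ^ N * (qsgn q N * qfac q r N) * qfac q p N"
    using qsaalschuetz_poly[where s = w and r = 1 and d = "p * x" and l = "x + w * p" and k = N]
    unfolding lhs by simp
  finally show ?thesis
    using nz qsgn_nonzero[OF q0, of N] by (simp add: field_simps)
qed

section \<open>Sears' transformation\<close>

lemma sum_triangle_swap:
  "(\<Sum>k\<le>n. \<Sum>j\<le>k. f k j) = (\<Sum>j\<le>n. \<Sum>m\<le>n - j. f (j + m) j)" for f :: "nat \<Rightarrow> nat \<Rightarrow> 'b::comm_monoid_add"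
proof -
  have "(\<Sum>k\<le>n. \<Sum>j\<le>k. f k j) = (\<Sum>k\<le>n. \<Sum>j\<le>k. f (j + (k - j)) j)"
    by (intro sum.cong) auto
  also have "\<dots> = (\<Sum>(j, m)\<in>{(j, m). j + m \<le> n}. f (j + m) j)"
    by (rule sum.triangle_reindex_eq[symmetric])
  also have "{(j, m). j + m \<le> n} = Sigma {..n} (\<lambda>j. {..n - j})"
    by auto
  finally show ?thesis
    by (simp add: sum.Sigma)
qed

text \<open>
  Sears' transformation of a balanced \<open>4\<phi>3\<close>: expand part of the summand by
  \<open>qsaalschuetz_poly\<close>, swap the sums, and evaluate the inner sum by \<open>qsaalschuetz\<close>.
\<close>

lemma sears_transformation:
  assumes u: "u * q = x * p * r * q ^ n" and y: "y = x * v" and g: "p * r = v * g"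
    and nz: "\<And>k. qfac q (x * p) k \<noteq> 0" "\<And>k. qfac q (x * r) k \<noteq> 0" "\<And>k. qfac q (y * s) k \<noteq> 0"
  shows "(\<Sum>k\<le>n. qsgn q k * q ^ k / q ^ (n * k) * qbin q n k * (qfac q x k * qfac q y k * qfac q (s * u) k)
            / (qfac q (y * s) k * qfac q (x * p) k * qfac q (x * r) k)) =
         x ^ n / (qfac q (x * p) n * qfac q (x * r) n) *
         (\<Sum>j\<le>n. qbin q n j * v ^ j * (qfac q x j * qfac q s j / qfac q (y * s) j)
            * qfac q (g * q ^ (n - j)) j * (qfac q p (n - j) * qfac q r (n - j)))"
proof -
  let ?c = "\<lambda>n k. qsgn q k * q ^ k / q ^ (n * k) * qbin q n k"
  let ?V = "\<lambda>j. \<Prod>i<j. u - y * q ^ i"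
  \<comment> \<open>Here the polynomial identity is used with its \<open>s\<close> and
    \<open>r\<close> equal to 1 and \<open>u\<close>, its \<open>d\<close> equal to
    \<open>y * s\<close> and its \<open>l\<close> equal to \<open>u * s + y\<close>. The factor
    \<open>qfac q u (k - j)\<close> is what the inner sum over \<open>m = k - j\<close>
    needs.\<close>
  have expand: "qfac q y k * qfac q (s * u) k / qfac q (y * s) k =
      (\<Sum>j\<le>k. qbin q k j * qfac q u (k - j) * (qfac q s j * ?V j / qfac q (y * s) j))" for k
  proof -
    have "qfac q y k * qfac q (s * u) k =
        (\<Prod>i<k. 1 + u * (y * s) * q ^ (2 * i) - q ^ i * (u * s + y))"
      unfolding qfac_def prod.distrib[symmetric]
      by (rule prod.cong) (auto simp: power_mult power2_eq_square algebra_simps power_mult_distrib)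
    also have "\<dots> = (\<Sum>j\<le>k. qbin q k j * (\<Prod>i<k - j. 1 - u * q ^ i) * qfac q (y * s * q ^ j) (k - j)
        * (\<Prod>i<j. u + 1 * (y * s) * q ^ (2 * i) - q ^ i * (u * s + y)))"
      by (rule qsaalschuetz_poly)
    also have "\<dots> = (\<Sum>j\<le>k. qbin q k j * qfac q u (k - j) * (qfac q s j * ?V j / qfac q (y * s) j)
        * qfac q (y * s) k)"
    proof (rule sum.cong)
      fix j assume "j \<in> {..k}"
      then obtain l where k: "k = j + l"
        using le_Suc_ex by (metis atMost_iff)
      have "(\<Prod>i<j. u + 1 * (y * s) * q ^ (2 * i) - q ^ i * (u * s + y)) = qfac q s j * ?V j"
        unfolding qfac_def prod.distrib[symmetric]
        by (rule prod.cong) (auto simp: power_mult power2_eq_square algebra_simps power_mult_distrib)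
      then show "qbin q k j * (\<Prod>i<k - j. 1 - u * q ^ i) * qfac q (y * s * q ^ j) (k - j)
          * (\<Prod>i<j. u + 1 * (y * s) * q ^ (2 * i) - q ^ i * (u * s + y)) =
          qbin q k j * qfac q u (k - j) * (qfac q s j * ?V j / qfac q (y * s) j) * qfac q (y * s) k"
        using nz(3)[of j] by (simp add: k qfac_add) (simp add: qfac_def)
    qed simp
    finally show ?thesis
      using nz(3)[of k] by (simp only: sum_distrib_right[symmetric] nonzero_mult_div_cancel_right simp_thms)
  qed
  \<comment> \<open>For fixed \<open>j\<close> the weight of length \<open>n\<close> leaves exactly
    the weight of a terminating sum of length \<open>n - j\<close>.\<close>
  have c_split: "?c n (j + m) * qbin q (j + m) j = ?c n j * ?c (n - j) m"
    if "j \<le> n" "m \<le> n - j" for j m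
  proof -
    obtain l where e: "n - j = m + l"
      using le_Suc_ex[OF \<open>m \<le> n - j\<close>] by blast
    then have n: "n = j + (m + l)" using \<open>j \<le> n\<close> by simp
    have "qsgn q (j + m) * q ^ (j + m) / q ^ (n * (j + m)) =
        (qsgn q j * q ^ j / q ^ (n * j)) * (qsgn q m * q ^ m / q ^ ((m + l) * m))"
    proof -
      have "q ^ (n * (j + m)) = q ^ (n * j) * q ^ ((m + l) * m) * q ^ (j * m)"
        by (simp add: n power_add[symmetric] algebra_simps)
      then show ?thesis
        using q0 by (simp add: qsgn_add power_add)
    qed
    then show ?thesis
      using qbin_trinomial[of j m l] by (simp add: e n[symmetric])
  qed
  \<comment> \<open>Balancing and \<open>p * r = v * g\<close> make \<open>x * v\<close> a common
    factor of \<open>u\<close> and \<open>y\<close>. What remains is a reversed shifted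
    factorial.\<close>
  have V: "?V j = (x * v) ^ j * (qsgn q j * qfac q (g * q ^ (n - j)) j)" if "j \<le> n" for j
  proof -
    have n: "q ^ n = q ^ (n - j) * q ^ j"
      using that by (simp add: power_add[symmetric])
    have "u = x * (p * r) * q ^ n / q"
      using u q0 by (simp add: field_simps)
    also have "\<dots> = x * v * ((g * q ^ (n - j)) * q ^ j / q)"
      unfolding g n by simp
    finally have "?V j = (\<Prod>i<j. (x * v) * ((g * q ^ (n - j)) * q ^ j / q - q ^ i))"
      unfolding y by (simp add: right_diff_distrib mult.assoc)
    also have "\<dots> = (x * v) ^ j * (\<Prod>i<j. (g * q ^ (n - j)) * q ^ j / q - q ^ i)"
      by (simp only: prod.distrib prod_constant card_lessThan power_mult_distrib)
    finally show ?thesis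
      by (simp only: prod_qpower_reverse[OF q0])
  qed
  let ?X = "\<lambda>k. qfac q x k / (qfac q (x * p) k * qfac q (x * r) k)"
  let ?W = "\<lambda>j. qfac q s j * ?V j / qfac q (y * s) j"
  have rearrange: "S * Q / E * C * (X / (P * R)) * (F * (A * B * (S * G)) / Y) *
      (K * L * (P2 * R2) / (P1 * R1)) =
      S * Q / E * S * L * A * K / (P * P1 * (R * R1)) * (C * B * (X * F / Y) * G * (P2 * R2))"
    for S Q E C X P R F A B G Y K L P1 P2 R1 R2 :: 'a
    by (simp add: divide_inverse ac_simps)
  have "(\<Sum>k\<le>n. ?c n k * (qfac q x k * qfac q y k * qfac q (s * u) k)
            / (qfac q (y * s) k * qfac q (x * p) k * qfac q (x * r) k)) =
        (\<Sum>k\<le>n. ?c n k * ?X k * (qfac q y k * qfac q (s * u) k / qfac q (y * s) k))"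
    by (simp add: ac_simps)
  also have "\<dots> = (\<Sum>k\<le>n. \<Sum>j\<le>k. ?c n k * ?X k * (qbin q k j * qfac q u (k - j) * ?W j))"
    by (simp only: expand sum_distrib_left)
  also have "\<dots> = (\<Sum>j\<le>n. \<Sum>m\<le>n - j. ?c n (j + m) * ?X (j + m) * (qbin q (j + m) j * qfac q u (j + m - j) * ?W j))"
    by (rule sum_triangle_swap)
  also have "\<dots> = (\<Sum>j\<le>n. x ^ n / (qfac q (x * p) n * qfac q (x * r) n) *
        (qbin q n j * v ^ j * (qfac q x j * qfac q s j / qfac q (y * s) j)
            * qfac q (g * q ^ (n - j)) j * (qfac q p (n - j) * qfac q r (n - j))))"
  proof (rule sum.cong)
    fix j assume "j \<in> {..n}"
    then have j: "j \<le> n" by simp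
    let ?x = "x * q ^ j" and ?N = "n - j"
    have n: "q ^ n = q ^ j * q ^ ?N"
      using j by (simp add: power_add[symmetric])
    have X: "?X (j + m) = ?X j * (qfac q ?x m / (qfac q (?x * p) m * qfac q (?x * r) m))" for m
      by (simp add: qfac_add ac_simps)
    have Xn: "qfac q (x * p) n = qfac q (x * p) j * qfac q (?x * p) ?N"
      "qfac q (x * r) n = qfac q (x * r) j * qfac q (?x * r) ?N"
      using qfac_add[of q "x * p" j ?N] qfac_add[of q "x * r" j ?N] j by (simp_all add: ac_simps)
    \<comment> \<open>The sign factor of the weight meets the one from \<open>V\<close>, and the
      inner sum contributes \<open>(q ^ j) ^ (n - j)\<close>. By \<open>qsgn_square\<close> all
      powers of \<open>q\<close> cancel.\<close>
    have powers: "qsgn q j * q ^ j / q ^ (n * j) * qsgn q j * (q ^ j) ^ ?N * x ^ j * x ^ ?N = x ^ n"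
    proof -
      have "qsgn q j * q ^ j * qsgn q j * (q ^ j) ^ ?N = (qsgn q j ^ 2 * q ^ j) * q ^ (j * ?N)"
        by (simp add: power2_eq_square power_mult)
      also have "\<dots> = q ^ (n * j)"
        unfolding qsgn_square using j
        by (simp add: power_add[symmetric] add_mult_distrib2[symmetric] mult.commute)
      finally have "qsgn q j * q ^ j * qsgn q j * (q ^ j) ^ ?N = q ^ (n * j)" .
      then have one: "qsgn q j * q ^ j / q ^ (n * j) * qsgn q j * (q ^ j) ^ ?N = 1"
        using q0 by simp
      show ?thesis
        unfolding one mult_1_left using j by (simp add: power_add[symmetric])
    qed
    have "(\<Sum>m\<le>?N. ?c n (j + m) * ?X (j + m) * (qbin q (j + m) j * qfac q u (j + m - j) * ?W j)) =
        (\<Sum>m\<le>?N. (?c n j * ?X j * ?W j) * (?c ?N m * (qfac q ?x m * qfac q u m)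
            / (qfac q (?x * p) m * qfac q (?x * r) m)))"
    proof (rule sum.cong)
      fix m assume "m \<in> {..?N}"
      then have m: "m \<le> ?N" by simp
      have "?c n (j + m) * ?X (j + m) * (qbin q (j + m) j * qfac q u (j + m - j) * ?W j) =
          (?c n (j + m) * qbin q (j + m) j) * ?X (j + m) * (qfac q u m * ?W j)"
        by (simp only: ac_simps add_diff_cancel_left')
      also have "\<dots> = (?c n j * ?c ?N m) * ?X (j + m) * (qfac q u m * ?W j)"
        by (simp only: c_split[OF j m])
      also have "\<dots> = (?c n j * ?X j * ?W j) * (?c ?N m * (qfac q ?x m * qfac q u m)
            / (qfac q (?x * p) m * qfac q (?x * r) m))"
        unfolding X by (simp only: times_divide_eq_left times_divide_eq_right ac_simps divide_divide_eq_left)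
      finally show "?c n (j + m) * ?X (j + m) * (qbin q (j + m) j * qfac q u (j + m - j) * ?W j) =
          (?c n j * ?X j * ?W j) * (?c ?N m * (qfac q ?x m * qfac q u m)
            / (qfac q (?x * p) m * qfac q (?x * r) m))" .
    qed simp
    also have "\<dots> = (?c n j * ?X j * ?W j) *
        (?x ^ ?N * (qfac q p ?N * qfac q r ?N) / (qfac q (?x * p) ?N * qfac q (?x * r) ?N))"
    proof -
      have nz': "qfac q (?x * p) ?N \<noteq> 0" "qfac q (?x * r) ?N \<noteq> 0"
        using nz(1,2)[of n] Xn by auto
      \<comment> \<open>Replacing \<open>x\<close> by \<open>x * q ^ j\<close> and \<open>n\<close>
        by \<open>n - j\<close> preserves the balancing condition, so \<open>qsaalschuetz\<close>
        evaluates the inner sum.\<close>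
      have "u * q = ?x * p * r * q ^ ?N"
        using u by (simp add: n ac_simps)
      from qsaalschuetz[OF this nz'] show ?thesis
        by (simp only: sum_distrib_left[symmetric])
    qed
    also have "\<dots> = (qsgn q j * q ^ j / q ^ (n * j) * qsgn q j * (q ^ j) ^ ?N * x ^ j * x ^ ?N)
          / (qfac q (x * p) n * qfac q (x * r) n) *
        (qbin q n j * v ^ j * (qfac q x j * qfac q s j / qfac q (y * s) j)
            * qfac q (g * q ^ (n - j)) j * (qfac q p (n - j) * qfac q r (n - j)))"
      unfolding V[OF j] Xn power_mult_distrib by (rule rearrange)
    also have "\<dots> = x ^ n / (qfac q (x * p) n * qfac q (x * r) n) *
        (qbin q n j * v ^ j * (qfac q x j * qfac q s j / qfac q (y * s) j)
            * qfac q (g * q ^ (n - j)) j * (qfac q p (n - j) * qfac q r (n - j)))"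
      by (simp only: powers)
    finally show "(\<Sum>m\<le>?N. ?c n (j + m) * ?X (j + m) * (qbin q (j + m) j * qfac q u (j + m - j) * ?W j)) =
        x ^ n / (qfac q (x * p) n * qfac q (x * r) n) *
        (qbin q n j * v ^ j * (qfac q x j * qfac q s j / qfac q (y * s) j)
            * qfac q (g * q ^ (n - j)) j * (qfac q p (n - j) * qfac q r (n - j)))" .
  qed simp
  finally show ?thesis
    by (simp only: sum_distrib_left)
qed

end

section \<open>Limits with geometric error bounds: arithmetic, telescoping and convolution\<close>

section \<open>Sequences converging at a geometric rate\<close>

text \<open>The bound is required at every index, not just eventually, because a convolution uses
  all indices \<open>n - j\<close> down to 0. The rate used later is \<open>sqrt q\<close>, whose
  powers are \<open>q powr (n / 2)\<close>.\<close>

definition geo_conv :: "real \<Rightarrow> (nat \<Rightarrow> complex) \<Rightarrow> complex \<Rightarrow> bool" where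
  "geo_conv r f L \<longleftrightarrow> (\<exists>M. \<forall>n. norm (f n - L) \<le> M * r ^ n)"

context
  fixes r :: real
  assumes r: "0 < r" "r < 1"
begin

lemma geo_conv_tendsto:
  assumes "geo_conv r f L"
  shows "f \<longlonglongrightarrow> L"
proof -
  obtain M where M: "\<And>n. norm (f n - L) \<le> M * r ^ n"
    using assms by (auto simp: geo_conv_def)
  have "(\<lambda>n. M * r ^ n) \<longlonglongrightarrow> 0"
    using r by (intro tendsto_mult_right_zero LIMSEQ_power_zero) auto
  then have "(\<lambda>n. f n - L) \<longlonglongrightarrow> 0"
    by (rule Lim_null_comparison[rotated]) (use M in auto)
  then show ?thesis
    by (simp add: LIM_zero_iff)
qed

lemma geo_conv_bounded:
  assumes "geo_conv r f L"
  obtains B where "B > 0" "\<And>n. norm (f n) \<le> B"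
  using convergent_imp_Bseq[OF convergentI[OF geo_conv_tendsto[OF assms]]]
  by (auto simp: Bseq_def)

lemma geo_conv_nonneg_bound:
  assumes "geo_conv r f L"
  obtains M where "M \<ge> 0" "\<And>n. norm (f n - L) \<le> M * r ^ n"
proof -
  obtain M where M: "\<And>n. norm (f n - L) \<le> M * r ^ n"
    using assms by (auto simp: geo_conv_def)
  then have "M \<ge> 0"
    using order_trans[OF norm_ge_zero M[of 0]] by simp
  then show ?thesis
    using M that by blast
qed

lemma geo_conv_mult:
  assumes "geo_conv r f L" "geo_conv r g K"
  shows "geo_conv r (\<lambda>n. f n * g n) (L * K)"
proof -
  obtain M where M: "M \<ge> 0" "\<And>n. norm (f n - L) \<le> M * r ^ n"
    using geo_conv_nonneg_bound[OF assms(1)] by blast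
  obtain M' where M': "M' \<ge> 0" "\<And>n. norm (g n - K) \<le> M' * r ^ n"
    using geo_conv_nonneg_bound[OF assms(2)] by blast
  obtain B where B: "B > 0" "\<And>n. norm (g n) \<le> B"
    using geo_conv_bounded[OF assms(2)] by blast
  have "norm (f n * g n - L * K) \<le> (M * B + norm L * M') * r ^ n" for n
  proof -
    have "f n * g n - L * K = (f n - L) * g n + L * (g n - K)"
      by (simp add: algebra_simps)
    then have "norm (f n * g n - L * K) \<le> norm (f n - L) * norm (g n) + norm L * norm (g n - K)"
      by (metis norm_mult norm_triangle_ineq)
    also have "\<dots> \<le> M * r ^ n * B + norm L * (M' * r ^ n)"
      using M B M' r by (intro add_mono mult_mono) auto
    finally show ?thesis
      by (simp add: algebra_simps)
  qed
  then show ?thesis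
    unfolding geo_conv_def by blast
qed

lemma geo_conv_inverse:
  assumes "geo_conv r f L" "L \<noteq> 0" "\<And>n. f n \<noteq> 0"
  shows "geo_conv r (\<lambda>n. inverse (f n)) (inverse L)"
proof -
  obtain M where M: "M \<ge> 0" "\<And>n. norm (f n - L) \<le> M * r ^ n"
    using geo_conv_nonneg_bound[OF assms(1)] by blast
  have "(\<lambda>n. inverse (f n)) \<longlonglongrightarrow> inverse L"
    using geo_conv_tendsto[OF assms(1)] assms(2) by (rule tendsto_inverse)
  from convergent_imp_Bseq[OF convergentI[OF this]]
  obtain B where B: "B > 0" "\<And>n. norm (inverse (f n)) \<le> B"
    by (auto simp: Bseq_def)
  have "norm (inverse (f n) - inverse L) \<le> (B * norm (inverse L) * M) * r ^ n" for n
  proof -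
    have "norm (inverse (f n) - inverse L) = norm (inverse (f n)) * norm (inverse L) * norm (f n - L)"
      using assms(2,3) by (simp add: inverse_diff_inverse norm_mult norm_minus_commute)
    also have "\<dots> \<le> B * norm (inverse L) * (M * r ^ n)"
      using M B r by (intro mult_mono) auto
    finally show ?thesis
      by (simp add: algebra_simps)
  qed
  then show ?thesis
    unfolding geo_conv_def by blast
qed

lemma geo_conv_divide:
  assumes "geo_conv r f L" "geo_conv r g K" "K \<noteq> 0" "\<And>n. g n \<noteq> 0"
  shows "geo_conv r (\<lambda>n. f n / g n) (L / K)"
  using geo_conv_mult[OF assms(1) geo_conv_inverse[OF assms(2-4)]]
  by (simp add: divide_inverse)

text \<open>The increments after index \<open>n\<close> are dominated by a geometric series; letting
  the upper index tend to infinity bounds the distance to the limit.\<close>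

lemma geo_conv_telescope:
  assumes d: "\<And>n. norm (f (Suc n) - f n) \<le> M * r ^ n" and L: "f \<longlonglongrightarrow> L"
  shows "geo_conv r f L"
proof -
  have M: "M \<ge> 0"
    using order_trans[OF norm_ge_zero d[of 0]] by simp
  \<comment> \<open>Keeping the exact partial sum (1 - r^k)/(1 - r) makes the induction on
    \<open>k\<close> close.\<close>
  have step: "norm (f (n + k) - f n) \<le> M * r ^ n * (1 - r ^ k) / (1 - r)" for n k
  proof (induction k)
    case (Suc k)
    have "norm (f (n + Suc k) - f n) \<le> norm (f (Suc (n + k)) - f (n + k)) + norm (f (n + k) - f n)"
      using norm_triangle_ineq[of "f (Suc (n + k)) - f (n + k)" "f (n + k) - f n"] by simp
    also have "\<dots> \<le> M * r ^ (n + k) + M * r ^ n * (1 - r ^ k) / (1 - r)"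
      using d Suc by (intro add_mono)
    also have "\<dots> = M * r ^ n * (1 - r ^ Suc k) / (1 - r)"
      using r by (simp add: power_add field_simps)
    finally show ?case .
  qed simp
  have "norm (f n - L) \<le> M / (1 - r) * r ^ n" for n
  proof -
    have "norm (f (n + k) - f n) \<le> M * r ^ n / (1 - r)" for k
    proof -
      have "M * r ^ n * (1 - r ^ k) \<le> M * r ^ n"
        using M r by (intro mult_left_le) auto
      then show ?thesis
        using step[of n k] r by (meson divide_right_mono diff_ge_0_iff_ge less_imp_le order_trans)
    qed
    moreover have "(\<lambda>k. norm (f (n + k) - f n)) \<longlonglongrightarrow> norm (L - f n)"
      using LIMSEQ_ignore_initial_segment[OF L, of n]
      by (intro tendsto_norm tendsto_diff tendsto_const) (simp add: add.commute)
    ultimately have "norm (L - f n) \<le> M * r ^ n / (1 - r)"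
      by (intro LIMSEQ_le_const2) auto
    then show ?thesis
      by (simp add: norm_minus_commute)
  qed
  then show ?thesis
    unfolding geo_conv_def by blast
qed

text \<open>Replace \<open>b (n - j)\<close> by \<open>L\<close>. The error terms are at most A M
  r^(2j) r^(n-j) = A M r^n r^j, which sum to O(r^n); decay of \<open>a\<close> like r^n alone would
  give a bound with an extra factor \<open>n\<close>. The rest is \<open>L\<close> times a tail of
  the series of \<open>a\<close>.\<close>

lemma geo_conv_convolution:
  assumes a: "\<And>n. norm (a n) \<le> A * r ^ (2 * n)" and b: "geo_conv r b L"
  shows "geo_conv r (\<lambda>n. \<Sum>j\<le>n. a j * b (n - j)) ((\<Sum>j. a j) * L)"
proof -
  obtain M where M: "M \<ge> 0" "\<And>n. norm (b n - L) \<le> M * r ^ n"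
    using geo_conv_nonneg_bound[OF b] by blast
  have A: "A \<ge> 0"
    using order_trans[OF norm_ge_zero a[of 0]] by simp
  have a': "norm (a n) \<le> A * r ^ n" for n
  proof -
    have "A * r ^ (2 * n) \<le> A * r ^ n"
      using A r by (intro mult_left_mono power_decreasing) auto
    then show ?thesis using a[of n] by linarith
  qed
  have "summable a"
    using r by (intro summable_comparison_test'[OF summable_mult[OF summable_geometric[of r], of A]])
      (auto intro: a')
  then have lim: "(\<lambda>n. \<Sum>j<n. a j) \<longlonglongrightarrow> (\<Sum>j. a j)"
    by (rule summable_LIMSEQ)
  have "geo_conv r (\<lambda>n. \<Sum>j<n. a j) (\<Sum>j. a j)"
    by (rule geo_conv_telescope[OF _ lim, of A]) (use a' in simp)
  then obtain M' where M': "M' \<ge> 0" "\<And>n. norm ((\<Sum>j<n. a j) - (\<Sum>j. a j)) \<le> M' * r ^ n"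
    using geo_conv_nonneg_bound by blast
  have "norm ((\<Sum>j\<le>n. a j * b (n - j)) - (\<Sum>j. a j) * L) \<le> (A * M / (1 - r) + M' * norm L) * r ^ n" for n
  proof -
    have "norm (\<Sum>j\<le>n. a j * (b (n - j) - L)) \<le> (\<Sum>j\<le>n. A * M * r ^ n * r ^ j)"
    proof (rule order_trans[OF norm_sum sum_mono])
      fix j assume "j \<in> {..n}"
      then have e: "r ^ n = r ^ j * r ^ (n - j)"
        by (simp add: power_add[symmetric])
      have "norm (a j * (b (n - j) - L)) \<le> (A * r ^ (2 * j)) * (M * r ^ (n - j))"
        unfolding norm_mult using a M A r by (intro mult_mono) auto
      also have "\<dots> = A * M * r ^ n * r ^ j"
        unfolding e by (simp add: mult_2 power_add)
      finally show "norm (a j * (b (n - j) - L)) \<le> A * M * r ^ n * r ^ j" .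
    qed
    also have "\<dots> = A * M * r ^ n * (\<Sum>j<Suc n. r ^ j)"
      by (simp only: sum_distrib_left lessThan_Suc_atMost)
    also have "\<dots> \<le> A * M * r ^ n * (1 / (1 - r))"
    proof (rule mult_left_mono)
      have "(\<Sum>j<Suc n. r ^ j) = (1 - r ^ Suc n) / (1 - r)"
        using r by (subst sum_gp_strict) simp
      also have "\<dots> \<le> 1 / (1 - r)"
        using r by (intro divide_right_mono) auto
      finally show "(\<Sum>j<Suc n. r ^ j) \<le> 1 / (1 - r)" .
    qed (use A M r in auto)
    finally have 1: "norm (\<Sum>j\<le>n. a j * (b (n - j) - L)) \<le> A * M / (1 - r) * r ^ n"
      by simp
    have "norm ((\<Sum>j\<le>n. a j) - (\<Sum>j. a j)) \<le> M' * r ^ Suc n"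
      using M'(2)[of "Suc n"] by (simp only: lessThan_Suc_atMost)
    also have "\<dots> \<le> M' * r ^ n"
      using M' r by (intro mult_left_mono power_decreasing) auto
    finally have 2: "norm (((\<Sum>j\<le>n. a j) - (\<Sum>j. a j)) * L) \<le> M' * norm L * r ^ n"
      using mult_right_mono[OF _ norm_ge_zero[of L]] by (fastforce simp: norm_mult ac_simps)
    have "(\<Sum>j\<le>n. a j * b (n - j)) - (\<Sum>j. a j) * L =
        (\<Sum>j\<le>n. a j * (b (n - j) - L)) + ((\<Sum>j\<le>n. a j) - (\<Sum>j. a j)) * L"
      by (simp add: algebra_simps sum_subtractf sum_distrib_left sum_distrib_right)
    then show ?thesis
      using norm_triangle_ineq[of "\<Sum>j\<le>n. a j * (b (n - j) - L)" "((\<Sum>j\<le>n. a j) - (\<Sum>j. a j)) * L"] 1 2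
      by (simp add: algebra_simps)
  qed
  then show ?thesis
    unfolding geo_conv_def by blast
qed

end

section \<open>Asymptotics\<close>

text \<open>The pattern with two leading entries makes rewriting stop at singleton lists.\<close>

lemma qpoch_inf_Cons: "qpoch_inf (a # b # as) q = qpoch_inf [a] q * qpoch_inf (b # as) q"
  by (simp add: qpoch_inf_def)

lemma norm_mult_less_1:
  fixes a b :: complex
  assumes "norm a < 1" "norm b \<le> 1"
  shows "norm (a * b) < 1"
proof -
  have "norm a * norm b \<le> norm a"
    using assms by (intro mult_left_le) auto
  then show ?thesis
    using assms by (simp add: norm_mult)
qed

text \<open>The two factors \<open>Q\<close> put into \<open>t3\<close> and \<open>t4\<close> raise
  the exponent (n - 1) - 1 in the second numerator parameter back to \<open>n\<close>.\<close>

lemma AW_S_eq_AW_T: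
  fixes Q :: complex
  assumes "n \<ge> 1" "Q \<noteq> 0"
  shows "AW_S n z t1 t2 t3 t4 Q =
    z * (1 - t3 / z) * (1 - t4 / z) * AW_T (n - 1) z t1 t2 (Q * t3) (Q * t4) Q"
proof -
  have "Q ^ n = Q * Q * Q powi (int (n - 1) - 1)"
    using assms by (cases n) (simp_all add: power_int_diff)
  then have c: "t1 * t2 * t3 * t4 * Q ^ n = t1 * t2 * (Q * t3) * (Q * t4) * Q powi (int (n - 1) - 1)"
    by simp
  have e: "1 - int n = - int (n - 1)" "Q * t1 * t3 = t1 * (Q * t3)" "Q * t1 * t4 = t1 * (Q * t4)"
    using assms by auto
  show ?thesis
    unfolding AW_S_def AW_T_def c e ..
qed

section \<open>Infinite q-shifted factorials: convergence, rate and nonvanishing\<close>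

context
  fixes q :: real
  assumes q: "0 < q" "q < 1"
begin

lemma convergent_prod_qfac: "convergent_prod (\<lambda>i. 1 - a * complex_of_real q ^ i)"
proof -
  have "summable (\<lambda>i. norm a * q ^ i)"
    using q by (intro summable_mult summable_geometric) auto
  then show ?thesis
    using q by (intro abs_convergent_prod_imp_convergent_prod summable_imp_abs_convergent_prod)
      (simp add: norm_mult norm_power)
qed

lemma qfac_tendsto: "qfac (complex_of_real q) a \<longlonglongrightarrow> qpoch_inf [a] (complex_of_real q)"
proof -
  have "(\<lambda>n. qfac (complex_of_real q) a (Suc n)) \<longlonglongrightarrow> qpoch_inf [a] (complex_of_real q)"
    using convergent_prod_LIMSEQ[OF convergent_prod_qfac[of a]]
    by (simp only: qfac_def qpoch_inf_def lessThan_Suc_atMost) simp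
  then show ?thesis
    by (rule LIMSEQ_imp_Suc)
qed

text \<open>Consecutive values differ by a bounded factor times \<open>q ^ n\<close>. The weaker
  rate \<open>sqrt q\<close> is recorded, since it is the one that survives convolution.\<close>

lemma qfac_geo_conv: "geo_conv (sqrt q) (qfac (complex_of_real q) a) (qpoch_inf [a] (complex_of_real q))"
proof -
  obtain B where B: "B > 0" "\<And>n. norm (qfac (complex_of_real q) a n) \<le> B"
    using convergent_imp_Bseq[OF convergentI[OF qfac_tendsto]] by (auto simp: Bseq_def)
  have "norm (qfac (complex_of_real q) a (Suc n) - qfac (complex_of_real q) a n) \<le> B * norm a * sqrt q ^ n" for n
  proof -
    have "qfac (complex_of_real q) a (Suc n) - qfac (complex_of_real q) a n =
        - (qfac (complex_of_real q) a n * a * complex_of_real q ^ n)"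
      by (simp add: qfac_Suc algebra_simps)
    then have "norm (qfac (complex_of_real q) a (Suc n) - qfac (complex_of_real q) a n) =
        norm (qfac (complex_of_real q) a n) * norm a * q ^ n"
      using q by (simp add: norm_mult norm_power)
    also have "\<dots> \<le> B * norm a * sqrt q ^ n"
    proof (intro mult_mono power_mono)
      show "q \<le> sqrt q"
        using q by (intro real_le_rsqrt) (simp add: power2_eq_square mult_le_one mult_left_le)
    qed (use B q in auto)
    finally show ?thesis .
  qed
  then show ?thesis
    using q qfac_tendsto by (intro geo_conv_telescope) auto
qed

lemma norm_qpower_less: "norm a < 1 \<Longrightarrow> norm (a * complex_of_real q ^ i) < 1"
proof -
  assume "norm a < 1"
  have "q ^ i \<le> 1" using q by (simp add: power_le_one)
  then have "norm a * q ^ i \<le> norm a"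
    by (intro mult_left_le) auto
  then show ?thesis
    using \<open>norm a < 1\<close> q by (simp add: norm_mult norm_power)
qed

lemma qpower_neq_1: "norm a < 1 \<Longrightarrow> a * complex_of_real q ^ i \<noteq> 1"
  using norm_qpower_less[of a i] by fastforce

lemma qfac_nonzero: "norm a < 1 \<Longrightarrow> qfac (complex_of_real q) a k \<noteq> 0"
  by (rule qfac_nonzeroI) (rule qpower_neq_1)

lemma qpoch_inf_nonzero:
  assumes "norm a < 1"
  shows "qpoch_inf [a] (complex_of_real q) \<noteq> 0"
proof -
  have "prodinf (\<lambda>i. 1 - a * complex_of_real q ^ i) \<noteq> 0"
    using prodinf_nonzero[OF convergent_prod_qfac] qpower_neq_1[OF assms]
    by (metis eq_iff_diff_eq_0)
  then show ?thesis
    by (simp add: qpoch_inf_def)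
qed

lemma qpoch_inf_shift:
  "qpoch_inf [a] (complex_of_real q) = (1 - a) * qpoch_inf [complex_of_real q * a] (complex_of_real q)"
proof (rule LIMSEQ_unique)
  show "(\<lambda>n. qfac (complex_of_real q) a (Suc n)) \<longlonglongrightarrow> qpoch_inf [a] (complex_of_real q)"
    using qfac_tendsto by (rule LIMSEQ_Suc)
  show "(\<lambda>n. qfac (complex_of_real q) a (Suc n))
      \<longlonglongrightarrow> (1 - a) * qpoch_inf [complex_of_real q * a] (complex_of_real q)"
    unfolding qfac_Suc_left mult.commute[of a]
    by (intro tendsto_mult tendsto_const qfac_tendsto)
qed

lemma of_real_q: "complex_of_real q \<noteq> 0" "complex_of_real q ^ Suc i \<noteq> 1"
  using q qpower_neq_1[of "complex_of_real q" i] by auto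

section \<open>Nonterminating 2phi1 series and the q-Gauss sum\<close>

lemma geo_conv_qfac_ratio:
  assumes "norm c < 1" "norm d < 1"
  shows "geo_conv (sqrt q)
      (\<lambda>n. qfac (complex_of_real q) a n * qfac (complex_of_real q) b n
         / (qfac (complex_of_real q) c n * qfac (complex_of_real q) d n))
      (qpoch_inf [a] (complex_of_real q) * qpoch_inf [b] (complex_of_real q)
         / (qpoch_inf [c] (complex_of_real q) * qpoch_inf [d] (complex_of_real q)))"
  using q assms
  by (intro geo_conv_divide geo_conv_mult qfac_geo_conv) (simp_all add: qpoch_inf_nonzero qfac_nonzero)

text \<open>The quotients of shifted factorials converge and are therefore bounded, so the terms
  decay like \<open>q ^ n = sqrt q ^ (2 * n)\<close>, as \<open>geo_conv_convolution\<close>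
  demands.\<close>

lemma hypergeometric_convolution:
  assumes "norm d < 1" "norm v \<le> q" "geo_conv (sqrt q) b L"
  shows "geo_conv (sqrt q)
      (\<lambda>n. \<Sum>j\<le>n. qfac (complex_of_real q) x j * qfac (complex_of_real q) s j
         / (qfac (complex_of_real q) q j * qfac (complex_of_real q) d j) * v ^ j * b (n - j))
      ((\<Sum>j. qfac (complex_of_real q) x j * qfac (complex_of_real q) s j
         / (qfac (complex_of_real q) q j * qfac (complex_of_real q) d j) * v ^ j) * L)"
proof -
  let ?h = "\<lambda>j. qfac (complex_of_real q) x j * qfac (complex_of_real q) s j
         / (qfac (complex_of_real q) q j * qfac (complex_of_real q) d j)"
  have r: "0 < sqrt q" "sqrt q < 1" using q by auto
  obtain B where B: "B > 0" "\<And>n. norm (?h n) \<le> B"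
    using geo_conv_bounded[OF r geo_conv_qfac_ratio[of "complex_of_real q" d x s]] q assms(1)
    by (metis abs_of_pos norm_of_real)
  have "norm (?h n * v ^ n) \<le> B * sqrt q ^ (2 * n)" for n
  proof -
    have "norm (v ^ n) \<le> q ^ n"
      unfolding norm_power using assms(2) by (intro power_mono) auto
    then have "norm (?h n * v ^ n) \<le> B * q ^ n"
      unfolding norm_mult using B by (intro mult_mono) auto
    then show ?thesis
      using q by (simp add: power_mult)
  qed
  then show ?thesis
    by (rule geo_conv_convolution[OF r _ assms(3)])
qed

text \<open>
  The \<open>q\<close>-Gauss sum, as the limit of the \<open>q\<close>-Pfaff-Saalschuetz identity when the number of
  terms tends to infinity.
\<close>

lemma q_gauss_sum:
  assumes v: "norm v \<le> q" and d: "d = v * x * s" "norm d < 1"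
  shows "(\<Sum>j. qfac (complex_of_real q) x j * qfac (complex_of_real q) s j
         / (qfac (complex_of_real q) q j * qfac (complex_of_real q) d j) * v ^ j) =
      qpoch_inf [v * x] (complex_of_real q) * qpoch_inf [v * s] (complex_of_real q)
        / (qpoch_inf [d] (complex_of_real q) * qpoch_inf [v] (complex_of_real q))"
proof -
  define Q where "Q = complex_of_real q"
  have r: "0 < sqrt q" "sqrt q < 1" using q by auto
  have Qn: "norm Q < 1" and vn: "norm v < 1"
    using q v by (auto simp: Q_def)
  note Q = of_real_q[folded Q_def]
  note nz = qfac_nonzero[folded Q_def]
  let ?a = "\<lambda>j. qfac Q x j * qfac Q s j / (qfac Q Q j * qfac Q d j) * v ^ j"
  let ?b = "\<lambda>j. qfac Q v j / qfac Q Q j"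
  have b: "geo_conv (sqrt q) ?b (qpoch_inf [v] Q / qpoch_inf [Q] Q)"
    using q Qn unfolding Q_def
    by (intro geo_conv_divide r qfac_geo_conv) (auto simp: qpoch_inf_nonzero qfac_nonzero)
  \<comment> \<open>In \<open>qsaalschuetz_poly\<close>, 1 and \<open>v\<close> are taken for its
    \<open>s\<close> and \<open>r\<close>, and \<open>v * (x + s)\<close> for its \<open>l\<close>.
    As \<open>d = v * x * s\<close>, all factors split, and the sum becomes a convolution.\<close>
  have id: "qfac Q (v * x) N * qfac Q (v * s) N =
      qfac Q Q N * qfac Q d N * (\<Sum>j\<le>N. ?a j * ?b (N - j))" for N
  proof -
    have "qfac Q (v * x) N * qfac Q (v * s) N =
        (\<Prod>i<N. 1 + v * d * Q ^ (2 * i) - Q ^ i * (v * (x + s)))"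
      unfolding qfac_def prod.distrib[symmetric] d(1)
      by (rule prod.cong) (auto simp: power_mult power2_eq_square algebra_simps power_mult_distrib)
    also have "\<dots> = (\<Sum>j\<le>N. qbin Q N j * (\<Prod>i<N - j. 1 - v * Q ^ i) * qfac Q (d * Q ^ j) (N - j)
        * (\<Prod>i<j. v + 1 * d * Q ^ (2 * i) - Q ^ i * (v * (x + s))))"
      by (rule qsaalschuetz_poly[OF Q])
    also have "\<dots> = (\<Sum>j\<le>N. qfac Q Q N * qfac Q d N * (?a j * ?b (N - j)))"
    proof (rule sum.cong)
      fix j assume j: "j \<in> {..N}"
      have "(\<Prod>i<j. v + 1 * d * Q ^ (2 * i) - Q ^ i * (v * (x + s))) =
          (\<Prod>i<j. v * ((1 - x * Q ^ i) * (1 - s * Q ^ i)))"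
        unfolding d(1)
        by (rule prod.cong) (auto simp: power_mult power2_eq_square algebra_simps power_mult_distrib)
      also have "\<dots> = v ^ j * (qfac Q x j * qfac Q s j)"
        by (simp only: prod.distrib prod_constant card_lessThan qfac_def)
      finally have P: "(\<Prod>i<j. v + 1 * d * Q ^ (2 * i) - Q ^ i * (v * (x + s))) =
          v ^ j * (qfac Q x j * qfac Q s j)" .
      have D: "qfac Q d N = qfac Q d j * qfac Q (d * Q ^ j) (N - j)"
        using j by (simp add: qfac_add[symmetric])
      have U: "(\<Prod>i<N - j. 1 - v * Q ^ i) = qfac Q v (N - j)"
        by (simp add: qfac_def)
      show "qbin Q N j * (\<Prod>i<N - j. 1 - v * Q ^ i) * qfac Q (d * Q ^ j) (N - j)
          * (\<Prod>i<j. v + 1 * d * Q ^ (2 * i) - Q ^ i * (v * (x + s))) =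
          qfac Q Q N * qfac Q d N * (?a j * ?b (N - j))"
        unfolding P D U using j nz[OF d(2), of j] by (simp add: qbin_def)
    qed simp
    finally show ?thesis
      by (simp only: sum_distrib_left)
  qed
  have "geo_conv (sqrt q) (\<lambda>n. \<Sum>j\<le>n. ?a j * ?b (n - j)) ((\<Sum>j. ?a j) * (qpoch_inf [v] Q / qpoch_inf [Q] Q))"
    using hypergeometric_convolution[OF d(2) v b] unfolding Q_def .
  note lim = geo_conv_tendsto[OF r this]
  \<comment> \<open>The same sequence has two limits, one through the convolution and one directly;
    equating them gives the series.\<close>
  have "(\<lambda>N. qfac Q (v * x) N * qfac Q (v * s) N) \<longlonglongrightarrow>
      qpoch_inf [Q] Q * qpoch_inf [d] Q * ((\<Sum>j. ?a j) * (qpoch_inf [v] Q / qpoch_inf [Q] Q))"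
    unfolding id by (intro tendsto_mult lim qfac_tendsto[folded Q_def])
  moreover have "(\<lambda>N. qfac Q (v * x) N * qfac Q (v * s) N) \<longlonglongrightarrow> qpoch_inf [v * x] Q * qpoch_inf [v * s] Q"
    by (intro tendsto_mult qfac_tendsto[folded Q_def])
  ultimately have eq: "qpoch_inf [v * x] Q * qpoch_inf [v * s] Q =
      qpoch_inf [Q] Q * qpoch_inf [d] Q * ((\<Sum>j. ?a j) * (qpoch_inf [v] Q / qpoch_inf [Q] Q))"
    by (rule LIMSEQ_unique[rotated])
  have "qpoch_inf [Q] Q \<noteq> 0" "qpoch_inf [d] Q \<noteq> 0" "qpoch_inf [v] Q \<noteq> 0"
    using qpoch_inf_nonzero[folded Q_def] Qn vn d(2) by auto
  then show ?thesis
    unfolding Q_def[symmetric] eq by simp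
qed

section \<open>Terminating 4phi3 series and the asymptotics of \<open>AW_T\<close>\<close>

lemma phi43_terminating:
  fixes a2 a3 a4 b1 b2 b3 :: complex
  defines "Q \<equiv> complex_of_real q"
  shows "phi43 (Q powi (- int n)) a2 a3 a4 b1 b2 b3 Q Q =
    (\<Sum>k\<le>n. qsgn Q k * Q ^ k / Q ^ (n * k) * qbin Q n k
       * (qfac Q a2 k * qfac Q a3 k * qfac Q a4 k) / (qfac Q b1 k * qfac Q b2 k * qfac Q b3 k))"
proof -
  note Q = of_real_q[folded Q_def]
  have nz: "qfac Q Q k \<noteq> 0" for k
    using qfac_q_nonzero[OF Q] .
  have fac: "1 - Q powi (- int n) * Q ^ i = (Q ^ n - Q ^ i) / Q ^ n" for i
    using Q(1) by (simp add: power_int_minus field_simps)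
  have top: "qfac Q (Q powi (- int n)) k = qsgn Q k / Q ^ (n * k) * qbin Q n k * qfac Q Q k" for k
  proof (cases "k \<le> n")
    case True
    \<comment> \<open>This is the shape required by \<open>prod_qpower_reverse\<close> with
      \<open>y = Q * Q ^ (n - k)\<close> and \<open>m = k\<close>.\<close>
    have n: "Q ^ n = (Q * Q ^ (n - k)) * Q ^ k / Q"
      using Q(1) True by (simp add: power_add[symmetric])
    have "qfac Q (Q powi (- int n)) k = (\<Prod>i<k. Q ^ n - Q ^ i) / Q ^ (n * k)"
      unfolding qfac_def fac by (simp add: prod_dividef power_mult)
    also have "(\<Prod>i<k. Q ^ n - Q ^ i) = qsgn Q k * qfac Q (Q * Q ^ (n - k)) k"
      by (subst n) (rule prod_qpower_reverse[OF Q(1)])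
    finally show ?thesis
      using True nz qfac_add[of Q Q "n - k" k] by (simp add: qbin_def)
  next
    case False
    \<comment> \<open>The factor with index \<open>n\<close> vanishes.\<close>
    then have "qfac Q (Q powi (- int n)) k = 0"
      using Q(1) by (auto simp: qfac_def power_int_minus intro!: bexI[of _ n])
    then show ?thesis
      using False by (simp add: qbin_def)
  qed
  have summand: "qpoch [Q powi (- int n), a2, a3, a4] Q k / qpoch [Q, b1, b2, b3] Q k * Q ^ k =
      qsgn Q k * Q ^ k / Q ^ (n * k) * qbin Q n k
       * (qfac Q a2 k * qfac Q a3 k * qfac Q a4 k) / (qfac Q b1 k * qfac Q b2 k * qfac Q b3 k)" for k
  proof -
    have "qpoch [Q powi (- int n), a2, a3, a4] Q k =
        qfac Q (Q powi (- int n)) k * (qfac Q a2 k * qfac Q a3 k * qfac Q a4 k)"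
      "qpoch [Q, b1, b2, b3] Q k = qfac Q Q k * (qfac Q b1 k * qfac Q b2 k * qfac Q b3 k)"
      by (simp_all add: qpoch_def qfac_def)
    then show ?thesis
      unfolding top using nz[of k] by (simp add: ac_simps)
  qed
  show ?thesis
    unfolding phi43_def summand by (rule suminf_finite) (auto simp: qbin_def)
qed

text \<open>Sears' transformation with \<open>t1 * z\<close> and \<open>Q * t1 / z\<close> as
  \<open>x\<close> and \<open>y\<close>, so that their ratio \<open>v = Q * w\<^sup>2\<close>
  becomes the argument of the new series. The reciprocal \<open>w\<close> of \<open>z\<close> is a
  separate variable, so the result applies equally with \<open>z\<close> and \<open>w\<close>
  exchanged.\<close>

lemma AW_T_convolution:
  fixes t1 t2 t3 t4 z w :: complex
  defines "Q \<equiv> complex_of_real q"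
  assumes zw: "z * w = 1"
    and t: "norm t1 < 1" "norm t2 < 1" "norm t3 < 1" "norm t4 < 1"
  shows "AW_T n z t1 t2 t3 t4 Q = (t1 * z) ^ n *
      ((qfac Q Q n * qfac Q (t2 * t4) n / (qfac Q (Q * (t1 * t2)) n * qfac Q (t1 * t4) n)) *
       (\<Sum>j\<le>n. qfac Q (t1 * z) j * qfac Q (t3 * z / Q) j / (qfac Q Q j * qfac Q (t1 * t3) j)
          * (Q * w\<^sup>2) ^ j
          * (qfac Q (Q * (t2 * w)) (n - j) * qfac Q (t4 * w) (n - j)
              / (qfac Q Q (n - j) * qfac Q (t2 * t4) (n - j)))))"
proof -
  note Q = of_real_q[folded Q_def]
  have z: "z \<noteq> 0" using zw by auto
  have w: "w = 1 / z" using zw z by (simp add: field_simps)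
  \<comment> \<open>The numerator parameters are \<open>x\<close>, \<open>y\<close>,
    \<open>s * u\<close> and the denominator parameters \<open>x * p\<close>, \<open>x * r\<close>,
    \<open>y * s\<close>.\<close>
  define x y v s p r g u where defs: "x = t1 * z" "y = Q * (t1 * w)" "v = Q * w\<^sup>2"
    "s = t3 * z / Q" "p = Q * (t2 * w)" "r = t4 * w" "g = t2 * t4" "u = t1 * t2 * t4 * Q ^ n * w"
  have xp: "x * p = Q * (t1 * t2)" and xr: "x * r = t1 * t4" and ys: "y * s = t1 * t3"
    and su: "s * u = t1 * t2 * t3 * t4 * Q powi (int n - 1)"
    using z Q(1) by (auto simp: defs w power_int_diff)
  have Qn: "norm Q < 1" using q by (simp add: Q_def)
  note nz = qfac_nonzero[folded Q_def]
  have n1: "norm (t1 * t2) < 1" "norm (t1 * t3) < 1" "norm (t1 * t4) < 1" "norm (t2 * t4) < 1"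
    using t by (simp_all add: norm_mult_less_1)
  then have n2: "norm (Q * (t1 * t2)) < 1"
    using Qn by (simp add: norm_mult_less_1)
  let ?c = "\<lambda>k. qsgn Q k * Q ^ k / Q ^ (n * k) * qbin Q n k"
  have "AW_T n z t1 t2 t3 t4 Q = (\<Sum>k\<le>n. ?c k * (qfac Q (s * u) k * qfac Q x k * qfac Q y k)
      / (qfac Q (x * p) k * qfac Q (y * s) k * qfac Q (x * r) k))"
    unfolding AW_T_def xp xr ys su using phi43_terminating[folded Q_def] z
    by (simp add: defs w mult.assoc)
  also have "\<dots> = (\<Sum>k\<le>n. ?c k * (qfac Q x k * qfac Q y k * qfac Q (s * u) k)
      / (qfac Q (y * s) k * qfac Q (x * p) k * qfac Q (x * r) k))"
    by (simp only: ac_simps)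
  also have "\<dots> = x ^ n / (qfac Q (x * p) n * qfac Q (x * r) n) *
         (\<Sum>j\<le>n. qbin Q n j * v ^ j * (qfac Q x j * qfac Q s j / qfac Q (y * s) j)
            * qfac Q (g * Q ^ (n - j)) j * (qfac Q p (n - j) * qfac Q r (n - j)))"
  proof (rule sears_transformation[OF Q])
    show "u * Q = x * p * r * Q ^ n" "y = x * v" "p * r = v * g"
      using z by (auto simp: defs w field_simps power2_eq_square)
    show "qfac Q (x * p) k \<noteq> 0" "qfac Q (x * r) k \<noteq> 0" "qfac Q (y * s) k \<noteq> 0" for k
      unfolding xp xr ys using n1 n2 by (simp_all add: nz)
  qed
  also have "\<dots> = x ^ n * ((qfac Q Q n * qfac Q g n / (qfac Q (x * p) n * qfac Q (x * r) n)) *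
       (\<Sum>j\<le>n. qfac Q x j * qfac Q s j / (qfac Q Q j * qfac Q (y * s) j) * v ^ j
          * (qfac Q p (n - j) * qfac Q r (n - j) / (qfac Q Q (n - j) * qfac Q g (n - j)))))"
  proof -
    have "qbin Q n j * v ^ j * (qfac Q x j * qfac Q s j / qfac Q (y * s) j)
            * qfac Q (g * Q ^ (n - j)) j * (qfac Q p (n - j) * qfac Q r (n - j)) =
        qfac Q Q n * qfac Q g n * (qfac Q x j * qfac Q s j / (qfac Q Q j * qfac Q (y * s) j) * v ^ j
          * (qfac Q p (n - j) * qfac Q r (n - j) / (qfac Q Q (n - j) * qfac Q g (n - j))))"
      if "j \<in> {..n}" for j
    proof -
      \<comment> \<open>Writing (g q^(n-j);q)_j as (g;q)_n / (g;q)_(n-j) separates the dependence on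
        \<open>j\<close> from that on \<open>n - j\<close>.\<close>
      have gn: "qfac Q g n = qfac Q g (n - j) * qfac Q (g * Q ^ (n - j)) j"
        using that by (simp add: qfac_add[symmetric])
      have "qfac Q g (n - j) \<noteq> 0"
        using n1 by (simp add: nz defs)
      then show ?thesis
        unfolding gn using that by (simp add: qbin_def ac_simps)
    qed
    then show ?thesis
      by (simp add: sum_distrib_left)
  qed
  finally show ?thesis
    unfolding xp xr ys unfolding defs .
qed

text \<open>Prefactor and convolution both converge at rate \<open>sqrt q\<close>. In the product of
  their limits \<open>P Q\<close> and \<open>P (t2 * t4)\<close> cancel. All remaining arguments
  have modulus below 1, so the limit is nonzero and the error can be made relative.\<close>

lemma AW_T_asymptotics:
  fixes t1 t2 t3 t4 z w :: complex
  defines "Q \<equiv> complex_of_real q"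
  defines "P \<equiv> \<lambda>a. qpoch_inf [a] Q"
  assumes z: "norm z = 1" "z * w = 1"
    and t: "norm t1 < 1" "norm t2 < 1" "norm t3 < 1" "norm t4 < 1"
  obtains e where "geo_conv (sqrt q) e 0"
    "\<And>n. AW_T n z t1 t2 t3 t4 Q = (t1 * z) ^ n *
      (P (Q * (t1 * w)) * P (Q * (t2 * w)) * P (t3 * w) * P (t4 * w)
        / (P (Q * w\<^sup>2) * P (Q * (t1 * t2)) * P (t1 * t3) * P (t1 * t4))) * (1 + e n)"
proof -
  note Q = of_real_q[folded Q_def]
  have r: "0 < sqrt q" "sqrt q < 1" using q by auto
  have w: "norm w = 1"
    using z by (metis mult_1 norm_mult norm_one)
  have w2: "norm (Q * w\<^sup>2) \<le> q"
    using w q by (simp add: Q_def norm_mult norm_power)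
  have Qn: "norm Q < 1" using q by (simp add: Q_def)
  note less = norm_mult_less_1
  have less': "norm (t * w) < 1" if "norm t < 1" for t
    using less[OF that, of w] w by simp
  have Pnz: "P a \<noteq> 0" if "norm a < 1" for a
    unfolding P_def Q_def using that by (rule qpoch_inf_nonzero)
  have n: "norm (t1 * t2) < 1" "norm (t1 * t3) < 1" "norm (t1 * t4) < 1" "norm (t2 * t4) < 1"
    "norm (Q * (t1 * t2)) < 1"
    using t Qn by (simp_all add: less less_imp_le)
  have Qt: "norm (Q * (t1 * w)) < 1" "norm (Q * (t2 * w)) < 1"
    using less[OF Qn] less'[OF t(1)] less'[OF t(2)] by (simp_all add: less_imp_le)
  define L where "L = P (Q * (t1 * w)) * P (Q * (t2 * w)) * P (t3 * w) * P (t4 * w)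
        / (P (Q * w\<^sup>2) * P (Q * (t1 * t2)) * P (t1 * t3) * P (t1 * t4))"
  have nz: "P Q \<noteq> 0" "P (t2 * t4) \<noteq> 0" "P (Q * w\<^sup>2) \<noteq> 0" "P (Q * (t1 * t2)) \<noteq> 0"
    "P (t1 * t3) \<noteq> 0" "P (t1 * t4) \<noteq> 0" "P (Q * (t1 * w)) \<noteq> 0" "P (Q * (t2 * w)) \<noteq> 0"
    "P (t3 * w) \<noteq> 0" "P (t4 * w) \<noteq> 0"
    using Qn w2 q n Qt t less' by (simp_all add: Pnz)
  have L0: "L \<noteq> 0"
    using nz by (simp add: L_def)
  define f where "f n = (qfac Q Q n * qfac Q (t2 * t4) n / (qfac Q (Q * (t1 * t2)) n * qfac Q (t1 * t4) n)) *
       (\<Sum>j\<le>n. qfac Q (t1 * z) j * qfac Q (t3 * z / Q) j / (qfac Q Q j * qfac Q (t1 * t3) j)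
          * (Q * w\<^sup>2) ^ j
          * (qfac Q (Q * (t2 * w)) (n - j) * qfac Q (t4 * w) (n - j)
              / (qfac Q Q (n - j) * qfac Q (t2 * t4) (n - j))))" for n
  have "(\<Sum>j. qfac Q (t1 * z) j * qfac Q (t3 * z / Q) j / (qfac Q Q j * qfac Q (t1 * t3) j)
          * (Q * w\<^sup>2) ^ j) =
        P ((Q * w\<^sup>2) * (t1 * z)) * P ((Q * w\<^sup>2) * (t3 * z / Q)) / (P (t1 * t3) * P (Q * w\<^sup>2))"
  proof -
    \<comment> \<open>This is the condition \<open>d = v * x * s\<close> of
      \<open>q_gauss_sum\<close>; the powers of \<open>z\<close> and \<open>w\<close>
      cancel.\<close>
    have "t1 * t3 = Q * w\<^sup>2 * (t1 * z) * (t3 * z / Q)"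
    proof -
      have "Q * w\<^sup>2 * (t1 * z) * (t3 * z / Q) = (z * w)\<^sup>2 * (t1 * t3)"
        using Q(1) by (simp add: power2_eq_square)
      then show ?thesis using z by simp
    qed
    then show ?thesis
      using q_gauss_sum[folded Q_def, OF w2 _ n(2)] by (simp only: P_def)
  qed
  also have "(Q * w\<^sup>2) * (t1 * z) = Q * (t1 * w)"
    using z(2) by (simp add: power2_eq_square mult.commute mult.left_commute)
  also have "(Q * w\<^sup>2) * (t3 * z / Q) = t3 * w"
    using z(2) Q(1) by (simp add: power2_eq_square mult.commute mult.left_commute)
  finally have gauss: "(\<Sum>j. qfac Q (t1 * z) j * qfac Q (t3 * z / Q) j / (qfac Q Q j * qfac Q (t1 * t3) j)
          * (Q * w\<^sup>2) ^ j) =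
        P (Q * (t1 * w)) * P (t3 * w) / (P (t1 * t3) * P (Q * w\<^sup>2))" .
  have "geo_conv (sqrt q) f
     ((P Q * P (t2 * t4) / (P (Q * (t1 * t2)) * P (t1 * t4))) *
      (P (Q * (t1 * w)) * P (t3 * w) / (P (t1 * t3) * P (Q * w\<^sup>2)) *
       (P (Q * (t2 * w)) * P (t4 * w) / (P Q * P (t2 * t4)))))"
    unfolding f_def P_def gauss[unfolded P_def, symmetric]
    using q n Qn unfolding Q_def
    by (intro geo_conv_mult r geo_conv_qfac_ratio hypergeometric_convolution w2[unfolded Q_def]) auto
  also have "(P Q * P (t2 * t4) / (P (Q * (t1 * t2)) * P (t1 * t4))) *
      (P (Q * (t1 * w)) * P (t3 * w) / (P (t1 * t3) * P (Q * w\<^sup>2)) *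
       (P (Q * (t2 * w)) * P (t4 * w) / (P Q * P (t2 * t4)))) = L"
    using nz by (simp add: L_def ac_simps)
  finally obtain M where M: "\<And>n. norm (f n - L) \<le> M * sqrt q ^ n"
    unfolding geo_conv_def by blast
  show thesis
  proof (rule that)
    have "norm (f n / L - 1) \<le> M / norm L * sqrt q ^ n" for n
    proof -
      have "norm (f n / L - 1) = norm (f n - L) / norm L"
        using L0 by (simp add: norm_divide[symmetric] diff_divide_distrib)
      then show ?thesis
        using M[of n] L0 by (simp add: divide_right_mono)
    qed
    then show "geo_conv (sqrt q) (\<lambda>n. f n / L - 1) 0"
      unfolding geo_conv_def by (intro exI[of _ "M / norm L"]) simp
    show "AW_T n z t1 t2 t3 t4 Q = (t1 * z) ^ n *
      (P (Q * (t1 * w)) * P (Q * (t2 * w)) * P (t3 * w) * P (t4 * w)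
        / (P (Q * w\<^sup>2) * P (Q * (t1 * t2)) * P (t1 * t3) * P (t1 * t4))) * (1 + (f n / L - 1))" for n
      unfolding L_def[symmetric]
      using AW_T_convolution[OF z(2) t, of n, folded Q_def] L0 by (simp add: f_def)
  qed
qed

section \<open>From \<open>AW_T\<close> to \<open>AW_R\<close>\<close>

text \<open>
  The symmetric function \<open>AW_R\<close> is a combination of \<open>AW_T\<close> at \<open>z\<close> and at \<open>1 / z\<close>: matching the
  two series term by term leaves an identity that is linear in \<open>q ^ k\<close>.
\<close>

lemma AW_R_eq_AW_T:
  fixes t1 t2 t3 t4 z w :: complex
  defines "Q \<equiv> complex_of_real q"
  assumes zw: "z * w = 1" and z2: "z\<^sup>2 \<noteq> 1"
    and t: "norm (t1 * t2) < 1"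
  shows "(1 - t1 * t2) * AW_R n z t1 t2 t3 t4 Q =
    (1 - t1 * w) * (1 - t2 * w) / (1 - w\<^sup>2) * AW_T n z t1 t2 t3 t4 Q
    + (1 - t1 * z) * (1 - t2 * z) / (1 - z\<^sup>2) * AW_T n w t1 t2 t3 t4 Q"
proof -
  have z: "z \<noteq> 0" using zw by auto
  have w: "w = 1 / z" using zw z by (simp add: field_simps)
  have Qn: "norm Q < 1" using q by (simp add: Q_def)
  note nz = qfac_nonzero[folded Q_def]
  let ?k = "\<lambda>k. qsgn Q k * Q ^ k / Q ^ (n * k) * qbin Q n k *
      qfac Q (t1 * t2 * t3 * t4 * Q powi (int n - 1)) k / (qfac Q (t1 * t3) k * qfac Q (t1 * t4) k)"
  have R: "AW_R n z t1 t2 t3 t4 Q =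
      (\<Sum>k\<le>n. ?k k * (qfac Q (t1 * z) k * qfac Q (t1 * w) k / qfac Q (t1 * t2) k))"
    unfolding AW_R_def using phi43_terminating[folded Q_def] by (simp add: w ac_simps)
  have T: "AW_T n z' t1 t2 t3 t4 Q =
      (\<Sum>k\<le>n. ?k k * (qfac Q (t1 * z') k * qfac Q (t1 * w' * Q) k / qfac Q (t1 * t2 * Q) k))"
    if "w' = 1 / z'" for z' w'
    unfolding AW_T_def using phi43_terminating[folded Q_def] by (simp add: that ac_simps)
  have wz: "z = 1 / w" using z w by simp
  have "(1 - t1 * t2) * (X * Y / qfac Q (t1 * t2) k) =
      (1 - t1 * w) * (1 - t2 * w) / (1 - w\<^sup>2) * (X * qfac Q (t1 * w * Q) k / qfac Q (t1 * t2 * Q) k)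
      + (1 - t1 * z) * (1 - t2 * z) / (1 - z\<^sup>2) * (Y * qfac Q (t1 * z * Q) k / qfac Q (t1 * t2 * Q) k)"
    if X: "X = qfac Q (t1 * z) k" and Y: "Y = qfac Q (t1 * w) k" for k X Y
  proof -
    have shift: "(1 - a) * qfac Q (a * Q) k = qfac Q a k * (1 - a * Q ^ k)" for a
      using qfac_Suc_left[of Q a k] by (simp add: qfac_Suc)
    have "norm (t1 * t2 * Q) < 1"
      using t Qn by (simp add: norm_mult_less_1)
    then have D: "qfac Q (t1 * t2 * Q) k \<noteq> 0" "qfac Q (t1 * t2) k \<noteq> 0"
      using t by (simp_all add: nz)
    have D': "(1 - t1 * t2) / qfac Q (t1 * t2) k = (1 - t1 * t2 * Q ^ k) / qfac Q (t1 * t2 * Q) k"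
      using shift[of "t1 * t2"] D by (simp add: field_simps)
    \<comment> \<open>Here \<open>c\<close> stands for \<open>Q ^ k\<close>. Both fractions get the
      denominator \<open>1 - z\<^sup>2\<close>, which is nonzero by \<open>z2\<close>, and a
      polynomial identity remains.\<close>
    have key: "(1 - t2 * w) / (1 - w\<^sup>2) * (1 - t1 * w * c) + (1 - t2 * z) / (1 - z\<^sup>2) * (1 - t1 * z * c) =
        1 - t1 * t2 * c" for c
    proof -
      have "1 - w\<^sup>2 = - (1 - z\<^sup>2) / z\<^sup>2"
        using z by (simp add: w field_simps)
      then have "(1 - t2 * w) / (1 - w\<^sup>2) * (1 - t1 * w * c) =
          - (z - t2) * (z - t1 * c) / (1 - z\<^sup>2)"
        using z z2 by (simp add: w field_simps power2_eq_square)
      moreover have "- (z - t2) * (z - t1 * c) + (1 - t2 * z) * (1 - t1 * z * c) =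
          (1 - t1 * t2 * c) * (1 - z\<^sup>2)"
        by (simp add: algebra_simps power2_eq_square)
      ultimately show ?thesis
        using z2 by (simp add: add_divide_distrib[symmetric])
    qed
    have "(1 - t1 * w) * (1 - t2 * w) / (1 - w\<^sup>2) * (X * qfac Q (t1 * w * Q) k / qfac Q (t1 * t2 * Q) k)
      + (1 - t1 * z) * (1 - t2 * z) / (1 - z\<^sup>2) * (Y * qfac Q (t1 * z * Q) k / qfac Q (t1 * t2 * Q) k) =
      (X * ((1 - t1 * w) * qfac Q (t1 * w * Q) k) * ((1 - t2 * w) / (1 - w\<^sup>2)) +
       Y * ((1 - t1 * z) * qfac Q (t1 * z * Q) k) * ((1 - t2 * z) / (1 - z\<^sup>2))) / qfac Q (t1 * t2 * Q) k"
      by (simp add: add_divide_distrib ac_simps)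
    also have "\<dots> = X * Y * ((1 - t2 * w) / (1 - w\<^sup>2) * (1 - t1 * w * Q ^ k)
        + (1 - t2 * z) / (1 - z\<^sup>2) * (1 - t1 * z * Q ^ k)) / qfac Q (t1 * t2 * Q) k"
      unfolding shift X[symmetric] Y[symmetric] distrib_left by (simp only: ac_simps)
    also have "\<dots> = X * Y * ((1 - t1 * t2) / qfac Q (t1 * t2) k)"
      unfolding key D' by simp
    finally show ?thesis by simp
  qed
  then have "(1 - t1 * t2) * (c * (qfac Q (t1 * z) k * qfac Q (t1 * w) k / qfac Q (t1 * t2) k)) =
      (1 - t1 * w) * (1 - t2 * w) / (1 - w\<^sup>2) *
        (c * (qfac Q (t1 * z) k * qfac Q (t1 * w * Q) k / qfac Q (t1 * t2 * Q) k))
      + (1 - t1 * z) * (1 - t2 * z) / (1 - z\<^sup>2) *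
        (c * (qfac Q (t1 * w) k * qfac Q (t1 * z * Q) k / qfac Q (t1 * t2 * Q) k))" for c k
    by (metis (no_types, lifting) distrib_left mult.left_commute)
  then show ?thesis
    unfolding R T[OF w] T[OF wz] sum_distrib_left by (simp only: sum.distrib)
qed

text \<open>\<open>AW_T_asymptotics\<close> is applied at \<open>z\<close> and at \<open>w\<close>.
  The coefficients in \<open>AW_R_eq_AW_T\<close> are the first factors that complete the shifted
  infinite products to unshifted ones.\<close>

lemma AW_R_asymptotics:
  fixes t1 t2 t3 t4 z w :: complex
  defines "Q \<equiv> complex_of_real q"
  defines "P \<equiv> \<lambda>a. qpoch_inf [a] Q"
  assumes z: "norm z = 1" "z * w = 1" "z\<^sup>2 \<noteq> 1"
    and t: "norm t1 < 1" "norm t2 < 1" "norm t3 < 1" "norm t4 < 1"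
  obtains e1 e2 where "geo_conv (sqrt q) e1 0" "geo_conv (sqrt q) e2 0"
    "\<And>n. P (t1 * t2) * P (t1 * t3) * P (t1 * t4) * AW_R n z t1 t2 t3 t4 Q =
      (t1 * w) ^ n * (P (t1 * z) * P (t2 * z) * P (t3 * z) * P (t4 * z) / P (z\<^sup>2)) * (1 + e1 n)
      + (t1 * z) ^ n * (P (t1 * w) * P (t2 * w) * P (t3 * w) * P (t4 * w) / P (w\<^sup>2)) * (1 + e2 n)"
proof -
  have w: "norm w = 1"
    using z by (metis mult_1 norm_mult norm_one)
  have wz: "w * z = 1"
    using z(2) by (simp add: mult.commute)
  obtain e2 where e2: "geo_conv (sqrt q) e2 0"
    "\<And>n. AW_T n z t1 t2 t3 t4 Q = (t1 * z) ^ n *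
      (P (Q * (t1 * w)) * P (Q * (t2 * w)) * P (t3 * w) * P (t4 * w)
        / (P (Q * w\<^sup>2) * P (Q * (t1 * t2)) * P (t1 * t3) * P (t1 * t4))) * (1 + e2 n)"
    using AW_T_asymptotics[OF z(1,2) t] unfolding Q_def P_def by metis
  obtain e1 where e1: "geo_conv (sqrt q) e1 0"
    "\<And>n. AW_T n w t1 t2 t3 t4 Q = (t1 * w) ^ n *
      (P (Q * (t1 * z)) * P (Q * (t2 * z)) * P (t3 * z) * P (t4 * z)
        / (P (Q * z\<^sup>2) * P (Q * (t1 * t2)) * P (t1 * t3) * P (t1 * t4))) * (1 + e1 n)"
    using AW_T_asymptotics[OF w wz t] unfolding Q_def P_def by metis
  have n: "norm (t1 * t2) < 1" "norm (t1 * t3) < 1" "norm (t1 * t4) < 1"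
    using t by (simp_all add: norm_mult_less_1 less_imp_le)
  have Pnz: "P a \<noteq> 0" if "norm a < 1" for a
    unfolding P_def Q_def using that by (rule qpoch_inf_nonzero)
  have shift: "P a = (1 - a) * P (Q * a)" for a
    unfolding P_def Q_def by (rule qpoch_inf_shift)
  have nz: "P (t1 * t2) \<noteq> 0" "P (t1 * t3) \<noteq> 0" "P (t1 * t4) \<noteq> 0"
    using n by (simp_all add: Pnz)
  have t12: "1 - t1 * t2 \<noteq> 0" "P (Q * (t1 * t2)) \<noteq> 0"
    using nz(1) shift[of "t1 * t2"] by auto
  \<comment> \<open>One statement serves \<open>a = z\<close> and \<open>a = w\<close>. If
    \<open>a\<^sup>2 = 1\<close>, both sides are 0 by division by zero.\<close>
  have part: "P (t1 * t2) * P (t1 * t3) * P (t1 * t4) / (1 - t1 * t2) *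
      ((1 - t1 * a) * (1 - t2 * a) / (1 - a\<^sup>2) * (x *
      (P (Q * (t1 * a)) * P (Q * (t2 * a)) * P (t3 * a) * P (t4 * a)
        / (P (Q * a\<^sup>2) * P (Q * (t1 * t2)) * P (t1 * t3) * P (t1 * t4))) * y)) =
      x * (P (t1 * a) * P (t2 * a) * P (t3 * a) * P (t4 * a) / P (a\<^sup>2)) * y" for a x y
    unfolding shift[of "t1 * t2"] shift[of "t1 * a"] shift[of "t2 * a"] shift[of "a\<^sup>2"]
    using t12 nz by (simp add: ac_simps)
  show thesis
  proof (rule that[OF e1(1) e2(1)])
    fix n
    have "P (t1 * t2) * P (t1 * t3) * P (t1 * t4) * AW_R n z t1 t2 t3 t4 Q =
        P (t1 * t2) * P (t1 * t3) * P (t1 * t4) / (1 - t1 * t2) * ((1 - t1 * t2) * AW_R n z t1 t2 t3 t4 Q)"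
      using t12 by simp
    also have "\<dots> = (t1 * z) ^ n * (P (t1 * w) * P (t2 * w) * P (t3 * w) * P (t4 * w) / P (w\<^sup>2)) * (1 + e2 n)
      + (t1 * w) ^ n * (P (t1 * z) * P (t2 * z) * P (t3 * z) * P (t4 * z) / P (z\<^sup>2)) * (1 + e1 n)"
      unfolding AW_R_eq_AW_T[OF z(2,3) n(1), folded Q_def] e1(2) e2(2) distrib_left part ..
    finally show "P (t1 * t2) * P (t1 * t3) * P (t1 * t4) * AW_R n z t1 t2 t3 t4 Q =
      (t1 * w) ^ n * (P (t1 * z) * P (t2 * z) * P (t3 * z) * P (t4 * z) / P (z\<^sup>2)) * (1 + e1 n)
      + (t1 * z) ^ n * (P (t1 * w) * P (t2 * w) * P (t3 * w) * P (t4 * w) / P (w\<^sup>2)) * (1 + e2 n)"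
      by (simp only: add.commute)
  qed
qed

section \<open>From rate \<open>sqrt q\<close> to \<open>bigO_qhalf\<close>\<close>

lemma sqrt_power_eq_powr: "sqrt q ^ n = q powr (real n / 2)"
  using q by (simp add: powr_half_sqrt[symmetric] powr_powr flip: powr_realpow)

lemma geo_conv_imp_bigO_qhalf:
  assumes "geo_conv (sqrt q) e 0"
  shows "e \<in> bigO_qhalf q"
proof -
  obtain M where "\<And>n. norm (e n) \<le> M * sqrt q ^ n"
    using assms by (auto simp: geo_conv_def)
  then show ?thesis
    using q unfolding bigO_qhalf_def
    by (intro bigoI[of _ M] always_eventually) (simp add: sqrt_power_eq_powr)
qed

text \<open>Shifting the index costs a factor 1 / sqrt q in the constant. The bound is claimed from
  \<open>n = 1\<close> on, where \<open>n - 1\<close> is not truncated.\<close>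

lemma geo_conv_imp_bigO_qhalf_shift:
  assumes "geo_conv (sqrt q) e 0"
  shows "(\<lambda>n. e (n - 1)) \<in> bigO_qhalf q"
proof -
  obtain M where M: "\<And>n. norm (e n) \<le> M * sqrt q ^ n"
    using assms by (auto simp: geo_conv_def)
  have "norm (e (n - 1)) \<le> M / sqrt q * sqrt q ^ n" if "n \<ge> 1" for n
    using M[of "n - 1"] q that by (cases n) auto
  then show ?thesis
    using q unfolding bigO_qhalf_def
    by (intro bigoI[of _ "M / sqrt q"] eventually_mono[OF eventually_ge_at_top[of 1]])
       (simp add: sqrt_power_eq_powr)
qed

end

section \<open>Assembly of the four asymptotic formulas\<close>

theorem theorem9p1:
  fixes q t1 t2 t3 t4 :: real and z :: complex
  assumes "0 < q" "q < 1"
    and "\<bar>t1\<bar> < 1" "\<bar>t2\<bar> < 1" "\<bar>t3\<bar> < 1" "\<bar>t4\<bar> < 1"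
    and "norm z = 1"
  shows
    "(z\<^sup>2 \<noteq> 1 \<longrightarrow>
       (\<exists>e1\<in>bigO_qhalf q. \<exists>e2\<in>bigO_qhalf q. \<forall>\<^sub>F n in sequentially.
          qpoch_inf [t1 * t2, t1 * t3, t1 * t4] q * AW_R n z t1 t2 t3 t4 q =
            (t1 / z) ^ n * (qpoch_inf [t1 * z, t2 * z, t3 * z, t4 * z] q / qpoch_inf [z\<^sup>2] q)
              * (1 + e1 n)
          + (t1 * z) ^ n * (qpoch_inf [t1 / z, t2 / z, t3 / z, t4 / z] q / qpoch_inf [1 / z\<^sup>2] q)
              * (1 + e2 n)))
   \<and> (\<exists>e\<in>bigO_qhalf q. \<forall>\<^sub>F n in sequentially.
          qpoch_inf [q / z\<^sup>2] q * qpoch_inf [q * t1 * t2, q * t1 * t3, q * t1 * t4] q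
            / qpoch_inf [q * t1 / z, q * t2 / z, t3 / z, t4 / z] q
            * AW_S n z t1 t2 t3 t4 q =
          t1 ^ (n - 1) * z ^ n * (1 + e n))
   \<and> (\<exists>e\<in>bigO_qhalf q. \<forall>\<^sub>F n in sequentially.
          qpoch_inf [q / z\<^sup>2] q * qpoch_inf [q * t1 * t2] q * qpoch_inf [t1 * t3, t1 * t4] q
            / qpoch_inf [q * t1 / z, t3 / z, q * t2 / z, t4 / z] q
            * AW_T n z t1 t2 t3 t4 q =
          (t1 * z) ^ n * (1 + e n))
   \<and> (z\<^sup>2 \<noteq> 1 \<longrightarrow>
       (\<exists>e1\<in>bigO_qhalf q. \<exists>e2\<in>bigO_qhalf q. \<forall>\<^sub>F n in sequentially.
          qpoch_inf [q * t1 * t2, q * t1 * t3, q * t1 * t4] q / (1 - q * t1 * t2)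
            * AW_U n z t1 t2 t3 t4 q =
            (q * t1) ^ (n - 1) / z ^ n
              * (qpoch_inf [t1 * z, t2 * z, t3 * z, t4 * z] q / qpoch_inf [z\<^sup>2] q)
              * (1 + e1 n)
          + (q * t1) ^ (n - 1) * z powi (int n - 2)
              * ((1 - t1 * z) * (1 - t2 * z) * qpoch_inf [t1 / z, t2 / z, t3 / z, t4 / z] q
                 / (qpoch_inf [1 / z\<^sup>2] q * (1 - t1 / z) * (1 - t2 / z)))
              * (1 + e2 n)))"
proof -
  define w where "w = 1 / z"
  have z0: "z \<noteq> 0" using assms(7) by auto
  have zw: "z * w = 1" using z0 by (simp add: w_def)
  have w: "norm w = 1" using assms(7) by (simp add: w_def norm_divide)
  have div_z: "a / z = a * w" "a / z\<^sup>2 = a * w\<^sup>2" "a / z ^ n = a * w ^ n" for a :: complex and n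
    by (simp_all add: w_def power_divide)
  note q = assms(1,2)
  define Q T1 T2 T3 T4 where defs: "Q = complex_of_real q" "T1 = complex_of_real t1"
    "T2 = complex_of_real t2" "T3 = complex_of_real t3" "T4 = complex_of_real t4"
  have T: "norm T1 < 1" "norm T2 < 1" "norm T3 < 1" "norm T4 < 1" and Qn: "norm Q < 1"
    using assms by (simp_all add: defs)
  have QT: "norm (Q * a) < 1" if "norm a < 1" for a
    using that Qn by (simp add: norm_mult_less_1)
  have Tw: "norm (a * w) < 1" if "norm a < 1" for a
    using that w by (simp add: norm_mult_less_1)
  define P where "P a = qpoch_inf [a] Q" for a
  have P_Cons: "qpoch_inf (a # b # as) Q = P a * qpoch_inf (b # as) Q" "qpoch_inf [a] Q = P a" for a b as
    by (simp_all only: qpoch_inf_Cons P_def)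
  have shift: "P a = (1 - a) * P (Q * a)" for a
    unfolding P_def defs by (rule qpoch_inf_shift[OF q])
  have Pnz: "P a \<noteq> 0" if "norm a < 1" for a
    unfolding P_def defs using q that by (rule qpoch_inf_nonzero)
  have Q0: "Q \<noteq> 0" using q by (simp add: defs)
  have nz: "P (Q * w\<^sup>2) \<noteq> 0" "P (Q * (T1 * T2)) \<noteq> 0" "P (Q * (T1 * T3)) \<noteq> 0" "P (Q * (T1 * T4)) \<noteq> 0"
    "P (T1 * T3) \<noteq> 0" "P (T1 * T4) \<noteq> 0"
    "P (Q * (T1 * w)) \<noteq> 0" "P (Q * (T2 * w)) \<noteq> 0" "P (T3 * w) \<noteq> 0" "P (T4 * w) \<noteq> 0"
    using T Qn w by (simp_all add: Pnz norm_mult_less_1 QT Tw norm_power less_imp_le)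

  have R: "\<exists>e1\<in>bigO_qhalf q. \<exists>e2\<in>bigO_qhalf q. \<forall>\<^sub>F n in sequentially.
      P (T1 * T2) * P (T1 * T3) * P (T1 * T4) * AW_R n z T1 T2 T3 T4 Q =
      (T1 * w) ^ n * (P (T1 * z) * P (T2 * z) * P (T3 * z) * P (T4 * z) / P (z\<^sup>2)) * (1 + e1 n)
      + (T1 * z) ^ n * (P (T1 * w) * P (T2 * w) * P (T3 * w) * P (T4 * w) / P (w\<^sup>2)) * (1 + e2 n)"
    if z2: "z\<^sup>2 \<noteq> 1"
  proof -
    obtain e1 e2 where e: "geo_conv (sqrt q) e1 0" "geo_conv (sqrt q) e2 0"
      "\<And>n. P (T1 * T2) * P (T1 * T3) * P (T1 * T4) * AW_R n z T1 T2 T3 T4 Q =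
      (T1 * w) ^ n * (P (T1 * z) * P (T2 * z) * P (T3 * z) * P (T4 * z) / P (z\<^sup>2)) * (1 + e1 n)
      + (T1 * z) ^ n * (P (T1 * w) * P (T2 * w) * P (T3 * w) * P (T4 * w) / P (w\<^sup>2)) * (1 + e2 n)"
      using AW_R_asymptotics[OF q assms(7) zw z2 T] unfolding P_def defs(1) by metis
    show ?thesis
      by (intro bexI[of _ e1] bexI[of _ e2] geo_conv_imp_bigO_qhalf[OF q] e(1,2) always_eventually allI e(3))
  qed

  have S: "\<exists>e\<in>bigO_qhalf q. \<forall>\<^sub>F n in sequentially.
      P (Q * w\<^sup>2) * (P (Q * (T1 * T2)) * P (Q * (T1 * T3)) * P (Q * (T1 * T4)))
        / (P (Q * (T1 * w)) * P (Q * (T2 * w)) * P (T3 * w) * P (T4 * w)) * AW_S n z T1 T2 T3 T4 Q =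
      T1 ^ (n - 1) * z ^ n * (1 + e n)"
  proof -
    obtain e where e: "geo_conv (sqrt q) e 0"
      "\<And>n. AW_T n z T1 T2 (Q * T3) (Q * T4) Q = (T1 * z) ^ n *
        (P (Q * (T1 * w)) * P (Q * (T2 * w)) * P (Q * T3 * w) * P (Q * T4 * w)
          / (P (Q * w\<^sup>2) * P (Q * (T1 * T2)) * P (T1 * (Q * T3)) * P (T1 * (Q * T4)))) * (1 + e n)"
      using AW_T_asymptotics[OF q assms(7) zw T(1,2) QT[OF T(3)] QT[OF T(4)]]
      unfolding P_def defs(1) by metis
    have "P (Q * w\<^sup>2) * (P (Q * (T1 * T2)) * P (Q * (T1 * T3)) * P (Q * (T1 * T4)))
        / (P (Q * (T1 * w)) * P (Q * (T2 * w)) * P (T3 * w) * P (T4 * w)) * AW_S n z T1 T2 T3 T4 Q =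
      T1 ^ (n - 1) * z ^ n * (1 + e (n - 1))" if n: "n \<ge> 1" for n
    proof -
      have z_pow: "z ^ n = z * z ^ (n - 1)"
        using n by (cases n) auto
      have ac: "T1 * (Q * T3) = Q * (T1 * T3)" "T1 * (Q * T4) = Q * (T1 * T4)"
        "Q * T3 * w = Q * (T3 * w)" "Q * T4 * w = Q * (T4 * w)"
        by simp_all
      show ?thesis
        \<comment> \<open>The prefactors 1 - t3/z and 1 - t4/z of \<open>AW_S\<close> cancel against
          the first factors of \<open>P (T3 * w)\<close> and \<open>P (T4 * w)\<close>.\<close>
        unfolding AW_S_eq_AW_T[OF n Q0] e(2) ac div_z shift[of "T3 * w"] shift[of "T4 * w"] z_pow
        using nz[unfolded shift[of "T3 * w"] shift[of "T4 * w"]]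
        by (simp add: power_mult_distrib)
    qed
    then show ?thesis
      by (intro bexI[OF _ geo_conv_imp_bigO_qhalf_shift[OF q e(1)]]
          eventually_mono[OF eventually_ge_at_top[of 1]])
  qed

  have T_asymp: "\<exists>e\<in>bigO_qhalf q. \<forall>\<^sub>F n in sequentially.
      P (Q * w\<^sup>2) * P (Q * (T1 * T2)) * (P (T1 * T3) * P (T1 * T4))
        / (P (Q * (T1 * w)) * P (T3 * w) * P (Q * (T2 * w)) * P (T4 * w)) * AW_T n z T1 T2 T3 T4 Q =
      (T1 * z) ^ n * (1 + e n)"
  proof -
    obtain e where e: "geo_conv (sqrt q) e 0"
      "\<And>n. AW_T n z T1 T2 T3 T4 Q = (T1 * z) ^ n *
        (P (Q * (T1 * w)) * P (Q * (T2 * w)) * P (T3 * w) * P (T4 * w)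
          / (P (Q * w\<^sup>2) * P (Q * (T1 * T2)) * P (T1 * T3) * P (T1 * T4))) * (1 + e n)"
      using AW_T_asymptotics[OF q assms(7) zw T] unfolding P_def defs(1) by metis
    show ?thesis
      by (rule bexI[OF _ geo_conv_imp_bigO_qhalf[OF q e(1)]]) (use nz in \<open>simp add: e(2)\<close>)
  qed

  have U: "\<exists>e1\<in>bigO_qhalf q. \<exists>e2\<in>bigO_qhalf q. \<forall>\<^sub>F n in sequentially.
      P (Q * (T1 * T2)) * P (Q * (T1 * T3)) * P (Q * (T1 * T4)) / (1 - Q * (T1 * T2))
        * AW_U n z T1 T2 T3 T4 Q =
      (Q * T1) ^ (n - 1) * w ^ n
        * (P (T1 * z) * P (T2 * z) * P (T3 * z) * P (T4 * z) / P (z\<^sup>2)) * (1 + e1 n)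
      + (Q * T1) ^ (n - 1) * z powi (int n - 2)
        * ((1 - T1 * z) * (1 - T2 * z) * (P (T1 * w) * P (T2 * w) * P (T3 * w) * P (T4 * w))
           / (P (w\<^sup>2) * (1 - T1 * w) * (1 - T2 * w))) * (1 + e2 n)" if z2: "z\<^sup>2 \<noteq> 1"
  proof -
    obtain e1 e2 where e: "geo_conv (sqrt q) e1 0" "geo_conv (sqrt q) e2 0"
      "\<And>n. P (Q * T1 * (Q * T2)) * P (Q * T1 * T3) * P (Q * T1 * T4) * AW_R n z (Q * T1) (Q * T2) T3 T4 Q =
      (Q * T1 * w) ^ n * (P (Q * T1 * z) * P (Q * T2 * z) * P (T3 * z) * P (T4 * z) / P (z\<^sup>2)) * (1 + e1 n)
      + (Q * T1 * z) ^ n * (P (Q * T1 * w) * P (Q * T2 * w) * P (T3 * w) * P (T4 * w) / P (w\<^sup>2)) * (1 + e2 n)"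
      using AW_R_asymptotics[OF q assms(7) zw z2 QT[OF T(1)] QT[OF T(2)] T(3,4)]
      unfolding P_def defs(1) by metis
    have "P (Q * (T1 * T2)) * P (Q * (T1 * T3)) * P (Q * (T1 * T4)) / (1 - Q * (T1 * T2))
        * AW_U n z T1 T2 T3 T4 Q =
      (Q * T1) ^ (n - 1) * w ^ n
        * (P (T1 * z) * P (T2 * z) * P (T3 * z) * P (T4 * z) / P (z\<^sup>2)) * (1 + e1 (n - 1))
      + (Q * T1) ^ (n - 1) * z powi (int n - 2)
        * ((1 - T1 * z) * (1 - T2 * z) * (P (T1 * w) * P (T2 * w) * P (T3 * w) * P (T4 * w))
           / (P (w\<^sup>2) * (1 - T1 * w) * (1 - T2 * w))) * (1 + e2 (n - 1))" if n: "n \<ge> 1" for n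
    proof -
      have w_pow: "w ^ n = w * w ^ (n - 1)"
        using n by (cases n) auto
      \<comment> \<open>For \<open>n = 1\<close> the exponent is -1, hence the integer power; the
        factor \<open>w\<close> is the 1/z in \<open>AW_U\<close>.\<close>
      have z_pow: "z powi (int n - 2) = w * z ^ (n - 1)"
        using n z0 by (cases n) (auto simp: power_int_diff w_def power2_eq_square)
      have ac: "Q * T1 * (Q * T2) = Q * (Q * (T1 * T2))" "Q * T1 * T3 = Q * (T1 * T3)"
        "Q * T1 * T4 = Q * (T1 * T4)" "Q * T1 * z = Q * (T1 * z)" "Q * T2 * z = Q * (T2 * z)"
        "Q * T1 * w = Q * (T1 * w)" "Q * T2 * w = Q * (T2 * w)"
        by simp_all
      \<comment> \<open>Each is a factor of an infinite product already known to be nonzero.\<close>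
      have one: "1 - Q * (T1 * T2) \<noteq> 0" "1 - T1 * w \<noteq> 0" "1 - T2 * w \<noteq> 0"
        using nz(2) Pnz[OF Tw[OF T(1)]] Pnz[OF Tw[OF T(2)]]
          shift[of "Q * (T1 * T2)"] shift[of "T1 * w"] shift[of "T2 * w"] by auto
      \<comment> \<open>Dividing by \<open>1 - Q * (T1 * T2)\<close> leaves
        \<open>P (Q * (Q * (T1 * T2)))\<close>, the product belonging to the shifted parameters
        \<open>Q * T1\<close> and \<open>Q * T2\<close>.\<close>
      have "P (Q * (T1 * T2)) * P (Q * (T1 * T3)) * P (Q * (T1 * T4)) / (1 - Q * (T1 * T2))
          * AW_U n z T1 T2 T3 T4 Q =
        w * (1 - T1 * z) * (1 - T2 * z) * (P (Q * (Q * (T1 * T2))) * P (Q * (T1 * T3)) * P (Q * (T1 * T4))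
          * AW_R (n - 1) z (Q * T1) (Q * T2) T3 T4 Q)"
        unfolding AW_U_def shift[of "Q * (T1 * T2)"] div_z using one by simp
      also have "\<dots> = w * (1 - T1 * z) * (1 - T2 * z) *
          ((Q * (T1 * w)) ^ (n - 1) * (P (Q * (T1 * z)) * P (Q * (T2 * z)) * P (T3 * z) * P (T4 * z)
              / P (z\<^sup>2)) * (1 + e1 (n - 1))
          + (Q * (T1 * z)) ^ (n - 1) * (P (Q * (T1 * w)) * P (Q * (T2 * w)) * P (T3 * w) * P (T4 * w)
              / P (w\<^sup>2)) * (1 + e2 (n - 1)))"
        using e(3)[of "n - 1", unfolded ac] by (simp only:)
      also have "\<dots> = (Q * T1) ^ (n - 1) * w ^ n
        * (P (T1 * z) * P (T2 * z) * P (T3 * z) * P (T4 * z) / P (z\<^sup>2)) * (1 + e1 (n - 1))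
      + (Q * T1) ^ (n - 1) * z powi (int n - 2)
        * ((1 - T1 * z) * (1 - T2 * z) * (P (T1 * w) * P (T2 * w) * P (T3 * w) * P (T4 * w))
           / (P (w\<^sup>2) * (1 - T1 * w) * (1 - T2 * w))) * (1 + e2 (n - 1))"
        unfolding w_pow z_pow shift[of "T1 * z"] shift[of "T2 * z"] shift[of "T1 * w"] shift[of "T2 * w"]
          distrib_left[of "w * (1 - T1 * z) * (1 - T2 * z)"]
        using one by (intro arg_cong2[where f = "(+)"]) (simp_all add: power_mult_distrib)
      finally show ?thesis .
    qed
    then show ?thesis
      by (intro bexI[OF bexI[OF _ geo_conv_imp_bigO_qhalf_shift[OF q e(2)]]
            geo_conv_imp_bigO_qhalf_shift[OF q e(1)]]
          eventually_mono[OF eventually_ge_at_top[of 1]])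
  qed

  \<comment> \<open>Facts and goal are brought to the same form: products nested to the right,
    multiplication by \<open>w\<close> instead of division by \<open>z\<close>, and lists split into
    single products.\<close>
  show ?thesis
    using R[unfolded mult.assoc] S[unfolded mult.assoc] T_asymp[unfolded mult.assoc] U[unfolded mult.assoc]
    unfolding list.map of_real_mult of_real_power of_real_diff of_real_1 defs[symmetric]
      P_Cons div_z mult_1_left mult.assoc
    by (intro conjI impI)
qed

end
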